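(* Let $F^*$ be the optimal value of the offline problem P1, let $\hat f(t)$ be the value of the slot-$t$ cost $f(t)$ when the decisions in every slot are given by an optimal solution of the online problem P2 with weight $V>0$, and let $\hat F=\lim_{T\to\infty}\frac1T\sum_{t=1}^T\mathbb E[\hat f(t)]$. Then the optimality gap is bounded by $$\hat F-F^*\le\frac1V\left(N_1+N_2+N_3\right),$$ where $$N_1=\frac12\sum_j\max\left\{\max_t A_j^2(t),\ \left(\sum_{i\in\Omega_j^F}M_{ij}\right)^2\right\},\quad N_2=\frac12\sum_i\max\left\{E_i^2,\ \left(\sum_{j\in\Omega_i^B}M_{ij}\right)^2\right\},\quad N_3=\frac12\sum_i\max\left\{(\eta_{\mathrm c}C_i)^2,\ \left(\frac{D_i}{\eta_{\mathrm d}}\right)^2\right\}.$$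
   Context: System. There are back ends $i\in\mathcal I=\{1,\dots,I\}$ and front ends $j\in\{1,\dots,J\}$; time slots $t=1,2,\dots,T$, with $T\to\infty$ in the long-run averages. $\Omega_j^F\subseteq\mathcal I$ is the set of back ends linked to front end $j$ and $\Omega_i^B$ is the set of front ends linked to back end $i$ (so $i\in\Omega_j^F\iff j\in\Omega_i^B$). Parameters. $\alpha_{ij}>0$ (bandwidth cost coefficient), $\gamma_j>0$ (disutility per unit of rejected workload), $\beta_i\ge0$ (battery cost coefficient), $\eta_{\mathrm c},\eta_{\mathrm d}\in(0,1]$ (charging and discharging efficiencies), nonnegative upper bounds $M_{ij},E_i,C_i,D_i,Q_j^F,Q_i^B,\overline U_{ik}$, and battery bounds $\underline B_i\le\overline B_i$. In slot $t$ there are uncertain (random) parameters: workload request $A_j(t)\ge0$, PV generation $z_i(t)\ge0$, electricity buying and selling prices $p_i^{\mathrm b}(t)\ge p_i^{\mathrm s}(t)>0$; $\mathbb E$ denotes expectation. Define $A_{j,\max}=\max_tA_j(t)$, $P^{\mathrm b}_{\max}=\max_{i,t}p_i^{\mathrm b}(t)$, $P^{\mathrm s}_{\min}=\min_{i,t}p_i^{\mathrm s}(t)$. Standing assumptions: for all $i$, $j$: $Q_j^F\ge A_{j,\max}+\sum_{i\in\Omega_j^F}M_{ij}$; $Q_i^B\ge E_i+\sum_{j\in\Omega_i^B}M_{ij}$; $\overline B_i-\underline B_i\ge\eta_{\mathrm c}C_i+\frac1{\eta_{\mathrm d}}D_i$; $P^{\mathrm b}_{\max}\eta_{\mathrm c}\eta_{\mathrm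 d}<P^{\mathrm s}_{\min}+\beta_i(1+\eta_{\mathrm c}\eta_{\mathrm d})$. Decision variables in slot $t$: accepted workloads $a_j(t)$; transferred workloads $m_{ij}(t)$ for $i\in\Omega_j^F$; processed workloads $e_i(t)$; electricity bought $x_i(t)$ and sold $y_i(t)$; charging $c_i(t)$ and discharging $d_i(t)$; shared energy $u_{ik}(t)$, $i,k\in\mathcal I$. Dynamics: $q_j^F(t+1)=q_j^F(t)+a_j(t)-\sum_{i\in\Omega_j^F}m_{ij}(t)$, with $q_j^F(1)=0$; $q_i^B(t+1)=q_i^B(t)+\sum_{j\in\Omega_i^B}m_{ij}(t)-e_i(t)$, with $q_i^B(1)=0$; $b_i(t+1)=b_i(t)+\eta_{\mathrm c}c_i(t)-\frac1{\eta_{\mathrm d}}d_i(t)$, with initial battery level $b_i(1)\in[\underline B_i,\overline B_i]$. Per-slot constraints: $0\le a_j(t)\le A_j(t)$; $0\le m_{ij}(t)\le M_{ij}$ for $i\in\Omega_j^F$; $0\le e_i(t)\le E_i$; $x_i(t)\ge0$, $y_i(t)\ge0$; $0\le c_i(t)\le C_i$; $0\le d_i(t)\le D_i$; $u_{ik}(t)+u_{ki}(t)=0$ and $-\overline U_{ik}\le u_{ik}(t)\le\overline U_{ik}$ for $k\ne i$; $u_{ii}(t)=0$; power balance $e_i(t)=x_i(t)-y_i(t)+d_i(t)-c_i(t)+z_i(t)+\sum_{k\in\mathcal I\setminus\{i\}}u_{ik}(t)$ for all $i$. Cost in slot $t$: $$f(t)=\sum_i\left[p_i^{\mathrm b}(t)x_i(t)-p_i^{\mathrm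 s}(t)y_i(t)+\beta_i\left(c_i(t)+d_i(t)\right)\right]+\sum_j\left[\sum_{i\in\Omega_j^F}\alpha_{ij}m_{ij}(t)+\gamma_j\left(A_j(t)-a_j(t)\right)\right].$$ Problem P1 (offline problem, with knowledge of all parameters over the whole time horizon): minimize $\lim_{T\to\infty}\frac1T\sum_{t=1}^T\mathbb E[f(t)]$ subject to the dynamics, the per-slot constraints, and $0\le q_j^F(t)\le Q_j^F$, $0\le q_i^B(t)\le Q_i^B$, $\underline B_i\le b_i(t)\le\overline B_i$ for all $i,j,t$. Virtual queues, with real parameters $\theta_j,\varphi_i,\delta_i,r_i$ and weight $V$: $h_j^F(t)=q_j^F(t)-\theta_j$, $h_i^B(t)=q_i^B(t)-\varphi_i$, $l_i(t)=b_i(t)-(\delta_i+r_iV)$. Drift term: $$g(t)=\sum_j h_j^F(t)\left(a_j(t)-\sum_{i\in\Omega_j^F}m_{ij}(t)\right)+\sum_i h_i^B(t)\left(\sum_{j\in\Omega_i^B}m_{ij}(t)-e_i(t)\right)+\sum_i l_i(t)\left(\eta_{\mathrm c}c_i(t)-\tfrac1{\eta_{\mathrm d}}d_i(t)\right).$$ Problem P2 (online problem, solved in each slot $t$ given the current states $q_j^F(t),q_i^B(t),b_i(t)$ and the current realized parameters; the optimal decisions then update the states through the dynamics): minimize $g(t)+Vf(t)$ over the slot-$t$ decision variables subject to the per-slot constraints only.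
   Formalization: The parameter vectors (workload requests, PV generation, prices) are assumed i.i.d. across time slots; without this the bound fails, e.g. when the buying price alternates between 2 and 1 in very long blocks. *)

theory Defs
  imports "HOL-Probability.Probability"
begin

text \<open>Back ends are indexed by the finite type \<open>'i\<close>, front ends by the finite type \<open>'j\<close>, and time
slots by the natural numbers \<open>t \<ge> 1\<close>. Data and decisions attached to a pair \<open>(i, j)\<close> are total
functions; their values at pairs outside \<open>links\<close> are never used.\<close>

record ('i, 'j) network =
  links :: "('i \<times> 'j) set"
  alpha :: "'i \<Rightarrow> 'j \<Rightarrow> real"
  gam :: "'j \<Rightarrow> real"
  bet :: "'i \<Rightarrow> real"
  eta_c :: real
  eta_d :: real
  M_ub :: "'i \<Rightarrow> 'j \<Rightarrow> real"
  E_ub :: "'i \<Rightarrow> real"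
  C_ub :: "'i \<Rightarrow> real"
  D_ub :: "'i \<Rightarrow> real"
  QF_ub :: "'j \<Rightarrow> real"
  QB_ub :: "'i \<Rightarrow> real"
  U_ub :: "'i \<Rightarrow> 'i \<Rightarrow> real"
  B_lb :: "'i \<Rightarrow> real"
  B_ub :: "'i \<Rightarrow> real"
  b_init :: "'i \<Rightarrow> real"

record ('i, 'j) slot_params =
  A_par :: "'j \<Rightarrow> real"
  z_par :: "'i \<Rightarrow> real"
  pb_par :: "'i \<Rightarrow> real"
  ps_par :: "'i \<Rightarrow> real"

record ('i, 'j) decision =
  a_dec :: "'j \<Rightarrow> real"
  m_dec :: "'i \<Rightarrow> 'j \<Rightarrow> real"
  e_dec :: "'i \<Rightarrow> real"
  x_dec :: "'i \<Rightarrow> real"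
  y_dec :: "'i \<Rightarrow> real"
  c_dec :: "'i \<Rightarrow> real"
  d_dec :: "'i \<Rightarrow> real"
  u_dec :: "'i \<Rightarrow> 'i \<Rightarrow> real"

record ('i, 'j) state =
  qF :: "'j \<Rightarrow> real"
  qB :: "'i \<Rightarrow> real"
  bat :: "'i \<Rightarrow> real"

definition OmegaF :: "('i, 'j) network \<Rightarrow> 'j \<Rightarrow> 'i set" where
  "OmegaF N j = {i. (i, j) \<in> links N}"

definition OmegaB :: "('i, 'j) network \<Rightarrow> 'i \<Rightarrow> 'j set" where
  "OmegaB N i = {j. (i, j) \<in> links N}"

definition valid_network :: "('i::finite, 'j::finite) network \<Rightarrow> bool" where
  "valid_network N \<longleftrightarrow>
     (\<forall>j. \<forall>i\<in>OmegaF N j. alpha N i j > 0 \<and> M_ub N i j \<ge> 0) \<and>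
     (\<forall>j. gam N j > 0 \<and> QF_ub N j \<ge> 0) \<and>
     (\<forall>i. bet N i \<ge> 0 \<and> E_ub N i \<ge> 0 \<and> C_ub N i \<ge> 0 \<and> D_ub N i \<ge> 0 \<and> QB_ub N i \<ge> 0) \<and>
     (\<forall>i k. k \<noteq> i \<longrightarrow> U_ub N i k \<ge> 0) \<and>
     0 < eta_c N \<and> eta_c N \<le> 1 \<and> 0 < eta_d N \<and> eta_d N \<le> 1 \<and>
     (\<forall>i. B_lb N i \<le> B_ub N i \<and> B_lb N i \<le> b_init N i \<and> b_init N i \<le> B_ub N i)"


subsection \<open>Uncertain parameters\<close>

text \<open>\<open>W t \<omega>\<close> are the parameters realized in slot \<open>t\<close>; \<open>slot_vec\<close> turns them into an element of a
Euclidean space, so that distributions and generated \<open>\<sigma>\<close>-algebras make sense.\<close>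

definition slot_vec ::
  "('i::finite, 'j::finite) slot_params \<Rightarrow> (real^'j) \<times> (real^'i) \<times> (real^'i) \<times> (real^'i)" where
  "slot_vec w = ((\<chi> j. A_par w j), (\<chi> i. z_par w i), (\<chi> i. pb_par w i), (\<chi> i. ps_par w i))"

text \<open>The information carried by the parameters of the slots in \<open>S\<close>.\<close>

definition info ::
  "'w measure \<Rightarrow> (nat \<Rightarrow> 'w \<Rightarrow> ('i::finite, 'j::finite) slot_params) \<Rightarrow> nat set \<Rightarrow> 'w measure" where
  "info M W S =
     vimage_algebra (space M) (\<lambda>\<omega>. \<lambda>s\<in>S. slot_vec (W s \<omega>)) (PiM S (\<lambda>_. borel))"

text \<open>Maxima and minima over \<open>t\<close> of random quantities are taken over all slots and realizations.
They are only used together with the boundedness conditions in \<open>valid_params\<close>.\<close>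

definition A_max ::
  "'w measure \<Rightarrow> (nat \<Rightarrow> 'w \<Rightarrow> ('i::finite, 'j::finite) slot_params) \<Rightarrow> 'j \<Rightarrow> real" where
  "A_max M W j = (SUP (t, \<omega>)\<in>{1..} \<times> space M. A_par (W t \<omega>) j)"

definition A_sq_max ::
  "'w measure \<Rightarrow> (nat \<Rightarrow> 'w \<Rightarrow> ('i::finite, 'j::finite) slot_params) \<Rightarrow> 'j \<Rightarrow> real" where
  "A_sq_max M W j = (SUP (t, \<omega>)\<in>{1..} \<times> space M. (A_par (W t \<omega>) j)\<^sup>2)"

definition Pb_max ::
  "'w measure \<Rightarrow> (nat \<Rightarrow> 'w \<Rightarrow> ('i::finite, 'j::finite) slot_params) \<Rightarrow> real" where
  "Pb_max M W = (SUP (i, t, \<omega>)\<in>UNIV \<times> {1..} \<times> space M. pb_par (W t \<omega>) i)"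

definition Ps_min ::
  "'w measure \<Rightarrow> (nat \<Rightarrow> 'w \<Rightarrow> ('i::finite, 'j::finite) slot_params) \<Rightarrow> real" where
  "Ps_min M W = (INF (i, t, \<omega>)\<in>UNIV \<times> {1..} \<times> space M. ps_par (W t \<omega>) i)"

definition valid_params ::
  "'w measure \<Rightarrow> (nat \<Rightarrow> 'w \<Rightarrow> ('i::finite, 'j::finite) slot_params) \<Rightarrow> bool" where
  "valid_params M W \<longleftrightarrow>
     (\<forall>t\<ge>1. \<forall>\<omega>\<in>space M.
        (\<forall>j. A_par (W t \<omega>) j \<ge> 0) \<and>
        (\<forall>i. z_par (W t \<omega>) i \<ge> 0 \<and> pb_par (W t \<omega>) i \<ge> ps_par (W t \<omega>) i \<and> ps_par (W t \<omega>) i > 0)) \<and>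
     (\<forall>j. bdd_above ((\<lambda>(t, \<omega>). A_par (W t \<omega>) j) ` ({1..} \<times> space M))) \<and>
     (\<forall>i. bdd_above ((\<lambda>(t, \<omega>). pb_par (W t \<omega>) i) ` ({1..} \<times> space M))) \<and>
     (\<forall>t\<ge>1. \<forall>i. integrable M (\<lambda>\<omega>. z_par (W t \<omega>) i))"

text \<open>Only the slots are independent of each other: the components of the parameter vector of one
slot may be correlated arbitrarily.\<close>

definition iid_params ::
  "'w measure \<Rightarrow> (nat \<Rightarrow> 'w \<Rightarrow> ('i::finite, 'j::finite) slot_params) \<Rightarrow> bool" where
  "iid_params M W \<longleftrightarrow>
     prob_space.indep_vars M (\<lambda>_. borel) (\<lambda>t \<omega>. slot_vec (W t \<omega>)) {1..} \<and>
     (\<forall>t\<ge>1. distr M borel (\<lambda>\<omega>. slot_vec (W t \<omega>)) = distr M borel (\<lambda>\<omega>. slot_vec (W 1 \<omega>)))"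

definition standing_assumptions ::
  "'w measure \<Rightarrow> (nat \<Rightarrow> 'w \<Rightarrow> ('i::finite, 'j::finite) slot_params) \<Rightarrow> ('i, 'j) network \<Rightarrow> bool" where
  "standing_assumptions M W N \<longleftrightarrow>
     (\<forall>j. QF_ub N j \<ge> A_max M W j + (\<Sum>i\<in>OmegaF N j. M_ub N i j)) \<and>
     (\<forall>i. QB_ub N i \<ge> E_ub N i + (\<Sum>j\<in>OmegaB N i. M_ub N i j)) \<and>
     (\<forall>i. B_ub N i - B_lb N i \<ge> eta_c N * C_ub N i + 1 / eta_d N * D_ub N i) \<and>
     (\<forall>i. Pb_max M W * eta_c N * eta_d N < Ps_min M W + bet N i * (1 + eta_c N * eta_d N))"


subsection \<open>Dynamics, per-slot constraints and cost\<close>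

definition init_state :: "('i, 'j) network \<Rightarrow> ('i, 'j) state" where
  "init_state N = \<lparr>qF = (\<lambda>_. 0), qB = (\<lambda>_. 0), bat = b_init N\<rparr>"

definition next_state ::
  "('i::finite, 'j::finite) network \<Rightarrow> ('i, 'j) state \<Rightarrow> ('i, 'j) decision \<Rightarrow> ('i, 'j) state" where
  "next_state N s d =
     \<lparr>qF = (\<lambda>j. qF s j + a_dec d j - (\<Sum>i\<in>OmegaF N j. m_dec d i j)),
      qB = (\<lambda>i. qB s i + (\<Sum>j\<in>OmegaB N i. m_dec d i j) - e_dec d i),
      bat = (\<lambda>i. bat s i + eta_c N * c_dec d i - 1 / eta_d N * d_dec d i)\<rparr>"

text \<open>The state at the beginning of slot \<open>t\<close>. The initial state belongs to slot 1; the value at 0 is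
irrelevant.\<close>

primrec state_at ::
  "('i::finite, 'j::finite) network \<Rightarrow> (nat \<Rightarrow> ('i, 'j) decision) \<Rightarrow> nat \<Rightarrow> ('i, 'j) state" where
  "state_at N ds 0 = init_state N"
| "state_at N ds (Suc t) = (if t = 0 then init_state N else next_state N (state_at N ds t) (ds t))"

definition slot_feasible ::
  "('i::finite, 'j::finite) network \<Rightarrow> ('i, 'j) slot_params \<Rightarrow> ('i, 'j) decision \<Rightarrow> bool" where
  "slot_feasible N w d \<longleftrightarrow>
     (\<forall>j. 0 \<le> a_dec d j \<and> a_dec d j \<le> A_par w j) \<and>
     (\<forall>j. \<forall>i\<in>OmegaF N j. 0 \<le> m_dec d i j \<and> m_dec d i j \<le> M_ub N i j) \<and>
     (\<forall>i. 0 \<le> e_dec d i \<and> e_dec d i \<le> E_ub N i) \<and>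
     (\<forall>i. 0 \<le> x_dec d i \<and> 0 \<le> y_dec d i) \<and>
     (\<forall>i. 0 \<le> c_dec d i \<and> c_dec d i \<le> C_ub N i) \<and>
     (\<forall>i. 0 \<le> d_dec d i \<and> d_dec d i \<le> D_ub N i) \<and>
     (\<forall>i k. k \<noteq> i \<longrightarrow> u_dec d i k + u_dec d k i = 0 \<and>
                      - U_ub N i k \<le> u_dec d i k \<and> u_dec d i k \<le> U_ub N i k) \<and>
     (\<forall>i. u_dec d i i = 0) \<and>
     (\<forall>i. e_dec d i = x_dec d i - y_dec d i + d_dec d i - c_dec d i + z_par w i
                      + (\<Sum>k\<in>UNIV - {i}. u_dec d i k))"

definition cost ::
  "('i::finite, 'j::finite) network \<Rightarrow> ('i, 'j) slot_params \<Rightarrow> ('i, 'j) decision \<Rightarrow> real" where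
  "cost N w d =
     (\<Sum>i\<in>UNIV. pb_par w i * x_dec d i - ps_par w i * y_dec d i + bet N i * (c_dec d i + d_dec d i)) +
     (\<Sum>j\<in>UNIV. (\<Sum>i\<in>OmegaF N j. alpha N i j * m_dec d i j) + gam N j * (A_par w j - a_dec d j))"

definition measurable_decision :: "'w measure \<Rightarrow> ('w \<Rightarrow> ('i, 'j) decision) \<Rightarrow> bool" where
  "measurable_decision F d \<longleftrightarrow>
     (\<forall>j. (\<lambda>\<omega>. a_dec (d \<omega>) j) \<in> borel_measurable F) \<and>
     (\<forall>i j. (\<lambda>\<omega>. m_dec (d \<omega>) i j) \<in> borel_measurable F) \<and>
     (\<forall>i. (\<lambda>\<omega>. e_dec (d \<omega>) i) \<in> borel_measurable F) \<and>
     (\<forall>i. (\<lambda>\<omega>. x_dec (d \<omega>) i) \<in> borel_measurable F) \<and>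
     (\<forall>i. (\<lambda>\<omega>. y_dec (d \<omega>) i) \<in> borel_measurable F) \<and>
     (\<forall>i. (\<lambda>\<omega>. c_dec (d \<omega>) i) \<in> borel_measurable F) \<and>
     (\<forall>i. (\<lambda>\<omega>. d_dec (d \<omega>) i) \<in> borel_measurable F) \<and>
     (\<forall>i k. (\<lambda>\<omega>. u_dec (d \<omega>) i k) \<in> borel_measurable F)"

text \<open>A policy \<open>P\<close> prescribes the decisions \<open>P t \<omega>\<close> of slot \<open>t\<close> under the realization \<open>\<omega>\<close>.\<close>

definition long_run_cost ::
  "'w measure \<Rightarrow> (nat \<Rightarrow> 'w \<Rightarrow> ('i::finite, 'j::finite) slot_params) \<Rightarrow> ('i, 'j) network \<Rightarrow>
   (nat \<Rightarrow> 'w \<Rightarrow> ('i, 'j) decision) \<Rightarrow> real \<Rightarrow> bool" where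
  "long_run_cost M W N P F \<longleftrightarrow>
     (\<lambda>T. 1 / real T * (\<Sum>t=1..T. (LINT \<omega>|M. cost N (W t \<omega>) (P t \<omega>)))) \<longlonglongrightarrow> F"


subsection \<open>Offline problem P1\<close>

text \<open>The decisions of every slot may depend on the parameters of all slots. Integrability excludes
policies of infinite expected cost, for which the Bochner integral would be 0 by convention.\<close>

definition P1_feasible ::
  "'w measure \<Rightarrow> (nat \<Rightarrow> 'w \<Rightarrow> ('i::finite, 'j::finite) slot_params) \<Rightarrow> ('i, 'j) network \<Rightarrow>
   (nat \<Rightarrow> 'w \<Rightarrow> ('i, 'j) decision) \<Rightarrow> bool" where
  "P1_feasible M W N P \<longleftrightarrow>
     (\<forall>t\<ge>1.
        measurable_decision (info M W {1..}) (P t) \<and>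
        integrable M (\<lambda>\<omega>. cost N (W t \<omega>) (P t \<omega>)) \<and>
        (\<forall>\<omega>\<in>space M.
           slot_feasible N (W t \<omega>) (P t \<omega>) \<and>
           (let s = state_at N (\<lambda>\<tau>. P \<tau> \<omega>) t in
              (\<forall>j. 0 \<le> qF s j \<and> qF s j \<le> QF_ub N j) \<and>
              (\<forall>i. 0 \<le> qB s i \<and> qB s i \<le> QB_ub N i) \<and>
              (\<forall>i. B_lb N i \<le> bat s i \<and> bat s i \<le> B_ub N i))))"

text \<open>For i.i.d. parameters satisfying \<open>valid_params\<close> and a valid network the set is nonempty (reject all workload and sell all PV
generation) and bounded below (the cost is bounded below by the PV revenue), so the infimum is not a
default value.\<close>

definition P1_value ::
  "'w measure \<Rightarrow> (nat \<Rightarrow> 'w \<Rightarrow> ('i::finite, 'j::finite) slot_params) \<Rightarrow> ('i, 'j) network \<Rightarrow> real" where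
  "P1_value M W N = Inf {F. \<exists>P. P1_feasible M W N P \<and> long_run_cost M W N P F}"


subsection \<open>Online problem P2\<close>

definition drift ::
  "('i::finite, 'j::finite) network \<Rightarrow> ('j \<Rightarrow> real) \<Rightarrow> ('i \<Rightarrow> real) \<Rightarrow> ('i \<Rightarrow> real) \<Rightarrow> ('i \<Rightarrow> real) \<Rightarrow> real \<Rightarrow>
   ('i, 'j) state \<Rightarrow> ('i, 'j) decision \<Rightarrow> real" where
  "drift N \<theta> \<phi> \<delta> r V s d =
     (\<Sum>j\<in>UNIV. (qF s j - \<theta> j) * (a_dec d j - (\<Sum>i\<in>OmegaF N j. m_dec d i j))) +
     (\<Sum>i\<in>UNIV. (qB s i - \<phi> i) * ((\<Sum>j\<in>OmegaB N i. m_dec d i j) - e_dec d i)) +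
     (\<Sum>i\<in>UNIV. (bat s i - (\<delta> i + r i * V)) * (eta_c N * c_dec d i - 1 / eta_d N * d_dec d i))"

definition P2_optimal ::
  "('i::finite, 'j::finite) network \<Rightarrow> ('j \<Rightarrow> real) \<Rightarrow> ('i \<Rightarrow> real) \<Rightarrow> ('i \<Rightarrow> real) \<Rightarrow> ('i \<Rightarrow> real) \<Rightarrow> real \<Rightarrow>
   ('i, 'j) state \<Rightarrow> ('i, 'j) slot_params \<Rightarrow> ('i, 'j) decision \<Rightarrow> bool" where
  "P2_optimal N \<theta> \<phi> \<delta> r V s w d \<longleftrightarrow>
     is_arg_min (\<lambda>d'. drift N \<theta> \<phi> \<delta> r V s d' + V * cost N w d') (slot_feasible N w) d"

text \<open>Measurability with respect to the parameters of the slots \<open>1, \<dots>, t\<close> makes the policy online: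
if P2 has several optimal solutions, the one chosen must not depend on future parameters.\<close>

definition P2_policy ::
  "'w measure \<Rightarrow> (nat \<Rightarrow> 'w \<Rightarrow> ('i::finite, 'j::finite) slot_params) \<Rightarrow> ('i, 'j) network \<Rightarrow>
   ('j \<Rightarrow> real) \<Rightarrow> ('i \<Rightarrow> real) \<Rightarrow> ('i \<Rightarrow> real) \<Rightarrow> ('i \<Rightarrow> real) \<Rightarrow> real \<Rightarrow>
   (nat \<Rightarrow> 'w \<Rightarrow> ('i, 'j) decision) \<Rightarrow> bool" where
  "P2_policy M W N \<theta> \<phi> \<delta> r V P \<longleftrightarrow>
     (\<forall>t\<ge>1.
        measurable_decision (info M W {1..t}) (P t) \<and>
        (\<forall>\<omega>\<in>space M.
           P2_optimal N \<theta> \<phi> \<delta> r V (state_at N (\<lambda>\<tau>. P \<tau> \<omega>) t) (W t \<omega>) (P t \<omega>)))"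


subsection \<open>Constants of the optimality gap\<close>

definition N1 ::
  "'w measure \<Rightarrow> (nat \<Rightarrow> 'w \<Rightarrow> ('i::finite, 'j::finite) slot_params) \<Rightarrow> ('i, 'j) network \<Rightarrow> real" where
  "N1 M W N = 1/2 * (\<Sum>j\<in>UNIV. max (A_sq_max M W j) ((\<Sum>i\<in>OmegaF N j. M_ub N i j)\<^sup>2))"

definition N2 :: "('i::finite, 'j::finite) network \<Rightarrow> real" where
  "N2 N = 1/2 * (\<Sum>i\<in>UNIV. max ((E_ub N i)\<^sup>2) ((\<Sum>j\<in>OmegaB N i. M_ub N i j)\<^sup>2))"

definition N3 :: "('i::finite, 'j::finite) network \<Rightarrow> real" where
  "N3 N = 1/2 * (\<Sum>i\<in>UNIV. max ((eta_c N * C_ub N i)\<^sup>2) ((D_ub N i / eta_d N)\<^sup>2))"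

end

theory Submission imports Defs
begin

text \<open>Half the squared norm of the virtual queues serves as a Lyapunov function. Its change in one slot is
the drift term \<open>g(t)\<close> of P2 plus half the squared norm of the state increment, and the latter is at
most \<open>N1 + N2 + N3\<close> (\<open>norm_increment_le\<close>). The changes telescope over the slots and the
Lyapunov function is nonnegative, so in expectation the time average of \<open>V\<close> times the online cost
exceeds the time average of the minimal value of \<open>g(t) + V f(t)\<close> by at most \<open>N1 + N2 + N3\<close>, up to a term of order \<open>1 / T\<close>
(\<open>online_bound\<close>). It remains to see that the minimal value of P2 is in expectation at most \<open>V\<close> times
the value of P1.

Let \<open>\<Phi>(h)\<close> be the expected minimal value of P2 when the virtual queues are held at a constant \<open>h\<close>.
The virtual queues of the online policy in slot \<open>t\<close> depend only on earlier slots and are therefore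
independent of the parameters of slot \<open>t\<close>; so the expected minimal value in slot \<open>t\<close> is the
expectation of \<open>\<Phi>\<close> at these virtual queues (\<open>expectation_value_at_past_state\<close>), and it suffices to
bound \<open>\<Phi>(h)\<close> for each \<open>h\<close>.

For this, let an arbitrary offline policy be given. Its decision in slot \<open>t\<close> is feasible for P2, so
\<open>\<Phi>(h)\<close> is at most the expectation of \<open>h\<close> times its increment plus \<open>V\<close> times its cost. Averaged over the
slots, the increments telescope to a difference of two states, which P1 confines to a bounded set;
their contribution tends to 0 and \<open>\<Phi>(h)\<close> is at most \<open>V\<close> times the long-run cost of the policy
(\<open>offline_bound\<close>). Comparing at a constant \<open>h\<close> in this way takes the place of the customary
comparison with a stationary randomized policy.

The independence argument needs the minimal value of P2 to be a Borel function of the virtual queues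
and the parameters, and the feasible set of P2 varies with the parameters; both points are settled by
describing decisions by controls with a fixed range.\<close>


section \<open>States and increments as vectors\<close>

definition state_vec :: "('i::finite, 'j::finite) state \<Rightarrow> (real^'j) \<times> (real^'i) \<times> (real^'i)" where
  "state_vec s = ((\<chi> j. qF s j), (\<chi> i. qB s i), (\<chi> i. bat s i))"

definition increment ::
  "('i::finite, 'j::finite) network \<Rightarrow> ('i, 'j) decision \<Rightarrow> (real^'j) \<times> (real^'i) \<times> (real^'i)" where
  "increment N d =
     ((\<chi> j. a_dec d j - (\<Sum>i\<in>OmegaF N j. m_dec d i j)),
      (\<chi> i. (\<Sum>j\<in>OmegaB N i. m_dec d i j) - e_dec d i),
      (\<chi> i. eta_c N * c_dec d i - 1 / eta_d N * d_dec d i))"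

text \<open>The components \<open>h\<^sup>F\<close>, \<open>h\<^sup>B\<close>, \<open>l\<close> of the virtual queues form one vector. In this form the Lyapunov
function of the drift-plus-penalty method is half the squared norm, and the drift term \<open>g(t)\<close> of P2
is the inner product of the virtual queues with the increment, that is, the first-order part of the
change of the Lyapunov function.\<close>

definition virtual_queues ::
  "('j::finite \<Rightarrow> real) \<Rightarrow> ('i::finite \<Rightarrow> real) \<Rightarrow> ('i \<Rightarrow> real) \<Rightarrow> ('i \<Rightarrow> real) \<Rightarrow> real \<Rightarrow>
   ('i, 'j) state \<Rightarrow> (real^'j) \<times> (real^'i) \<times> (real^'i)" where
  "virtual_queues \<theta> \<phi> \<delta> r V s =
     state_vec s - ((\<chi> j. \<theta> j), (\<chi> i. \<phi> i), (\<chi> i. \<delta> i + r i * V))"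

lemma state_vec_next_state: "state_vec (next_state N s d) = state_vec s + increment N d"
  by (simp add: state_vec_def next_state_def increment_def vec_eq_iff algebra_simps)

lemma drift_eq_inner: "drift N \<theta> \<phi> \<delta> r V s d = virtual_queues \<theta> \<phi> \<delta> r V s \<bullet> increment N d"
  by (simp add: drift_def virtual_queues_def state_vec_def increment_def inner_vec_def)

lemma borel_measurable_vec_lambda:
  fixes f :: "'n::finite \<Rightarrow> 'a \<Rightarrow> real"
  assumes "\<And>i. f i \<in> borel_measurable F"
  shows "(\<lambda>x. \<chi> i. f i x) \<in> borel_measurable F"
proof (subst borel_measurable_euclidean_space, rule ballI)
  fix b :: "real^'n" assume "b \<in> Basis"
  then obtain i where "b = axis i 1"
    by (auto simp: Basis_vec_def)
  then show "(\<lambda>x. (\<chi> i. f i x) \<bullet> b) \<in> borel_measurable F"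
    using assms[of i] by (simp add: inner_axis)
qed

text \<open>An inflow \<open>u\<close> and an outflow \<open>v\<close> of a queue partly cancel, so the net change never exceeds the larger
of the two; this is where the maxima in \<open>N1\<close>, \<open>N2\<close>, \<open>N3\<close> come from.\<close>

lemma diff_square_le_max:
  fixes u v x y :: real
  assumes "0 \<le> u" "u\<^sup>2 \<le> x" "0 \<le> v" "v \<le> y"
  shows "(u - v)\<^sup>2 \<le> max x (y\<^sup>2)"
proof (cases "u \<le> v")
  case True
  then have "(u - v)\<^sup>2 \<le> y\<^sup>2"
    using assms by (intro power2_le_iff_abs_le[THEN iffD2]) auto
  then show ?thesis by simp
next
  case False
  then have "(u - v)\<^sup>2 \<le> u\<^sup>2"
    using assms by (intro power_mono) auto
  with assms show ?thesis by simp
qed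

text \<open>The second-order part of the change of the Lyapunov function: each queue contributes the square of
inflow minus outflow.\<close>

lemma norm_increment_le:
  assumes net: "valid_network N" and feas: "slot_feasible N w d"
    and A: "\<And>j. (A_par w j)\<^sup>2 \<le> A_sq_max M W j"
  shows "(norm (increment N d))\<^sup>2 \<le> 2 * (N1 M W N + N2 N + N3 N)"
proof -
  have m: "0 \<le> m_dec d i j \<and> m_dec d i j \<le> M_ub N i j" if "(i, j) \<in> links N" for i j
    using feas that by (auto simp: slot_feasible_def OmegaF_def)
  have F: "(a_dec d j - (\<Sum>i\<in>OmegaF N j. m_dec d i j))\<^sup>2
      \<le> max (A_sq_max M W j) ((\<Sum>i\<in>OmegaF N j. M_ub N i j)\<^sup>2)" for j
  proof (rule diff_square_le_max)
    have "0 \<le> a_dec d j" "a_dec d j \<le> A_par w j"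
      using feas by (auto simp: slot_feasible_def)
    then show "0 \<le> a_dec d j" "(a_dec d j)\<^sup>2 \<le> A_sq_max M W j"
      using order_trans[OF power_mono[of "a_dec d j" "A_par w j" 2] A[of j]] by auto
  qed (auto intro!: sum_nonneg sum_mono simp: m OmegaF_def)
  have B: "((\<Sum>j\<in>OmegaB N i. m_dec d i j) - e_dec d i)\<^sup>2
      \<le> max ((E_ub N i)\<^sup>2) ((\<Sum>j\<in>OmegaB N i. M_ub N i j)\<^sup>2)" for i
    using feas unfolding power2_commute[of "\<Sum>j\<in>OmegaB N i. m_dec d i j"]
    by (intro diff_square_le_max power_mono)
      (auto intro!: sum_nonneg sum_mono simp: m OmegaB_def slot_feasible_def)
  have C: "(eta_c N * c_dec d i - 1 / eta_d N * d_dec d i)\<^sup>2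
      \<le> max ((eta_c N * C_ub N i)\<^sup>2) ((D_ub N i / eta_d N)\<^sup>2)" for i
    using feas net
    by (intro diff_square_le_max power_mono)
      (auto intro!: mult_left_mono divide_right_mono simp: slot_feasible_def valid_network_def)
  have "(norm (increment N d))\<^sup>2 = increment N d \<bullet> increment N d"
    by (simp add: power2_norm_eq_inner)
  also have "\<dots> = (\<Sum>j\<in>UNIV. (a_dec d j - (\<Sum>i\<in>OmegaF N j. m_dec d i j))\<^sup>2)
      + (\<Sum>i\<in>UNIV. ((\<Sum>j\<in>OmegaB N i. m_dec d i j) - e_dec d i)\<^sup>2)
      + (\<Sum>i\<in>UNIV. (eta_c N * c_dec d i - 1 / eta_d N * d_dec d i)\<^sup>2)"
    by (simp add: increment_def inner_vec_def power2_eq_square)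
  also have "\<dots> \<le> 2 * (N1 M W N + N2 N + N3 N)"
    using add_mono[OF add_mono[OF sum_mono[of UNIV, OF F] sum_mono[of UNIV, OF B]] sum_mono[of UNIV, OF C]]
    by (simp add: N1_def N2_def N3_def)
  finally show ?thesis .
qed


section \<open>The value of the slot problem\<close>

text \<open>The inverse of \<open>slot_vec\<close>, which lets the optimal value of P2 be a function on a Euclidean space.\<close>

definition params_of ::
  "(real^'j) \<times> (real^'i) \<times> (real^'i) \<times> (real^'i) \<Rightarrow> ('i::finite, 'j::finite) slot_params" where
  "params_of v = \<lparr>A_par = ($) (fst v), z_par = ($) (fst (snd v)),
     pb_par = ($) (fst (snd (snd v))), ps_par = ($) (snd (snd (snd v)))\<rparr>"

lemma params_of_slot_vec [simp]: "params_of (slot_vec w) = w"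
  by (cases w) (simp add: params_of_def slot_vec_def fun_eq_iff)

text \<open>The set of feasible decisions moves with the realized parameters. A control describes a decision by
data whose range does not: the accepted workload is given as a fraction \<open>\<rho>\<close> of the request, and
the market trades are left out, because the power balance leaves only their difference, which is
bought or sold but not both. Every feasible decision is thereby matched by a control of no greater
cost, and P2 becomes a minimization over a set that does not depend on the parameters.\<close>

type_synonym ('i, 'j) control =
  "(real^'j) \<times> (real^'j^'i) \<times> (real^'i) \<times> (real^'i) \<times> (real^'i) \<times> (real^'i^'i)"

definition decision_of ::
  "('i::finite, 'j::finite) slot_params \<Rightarrow> ('i, 'j) control \<Rightarrow> ('i, 'j) decision" where
  "decision_of w k = (case k of (\<rho>, \<mu>, e, c, d, u) \<Rightarrow>
     \<lparr>a_dec = (\<lambda>j. \<rho> $ j * A_par w j), m_dec = (\<lambda>i j. \<mu> $ i $ j), e_dec = ($) e,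
      x_dec = (\<lambda>i. max 0 (e $ i - d $ i + c $ i - z_par w i - (\<Sum>k\<in>UNIV - {i}. u $ i $ k))),
      y_dec = (\<lambda>i. max 0 (- (e $ i - d $ i + c $ i - z_par w i - (\<Sum>k\<in>UNIV - {i}. u $ i $ k)))),
      c_dec = ($) c, d_dec = ($) d, u_dec = (\<lambda>i k. u $ i $ k)\<rparr>)"

text \<open>When \<open>A_par w j = 0\<close> the fraction is \<open>0 / 0 = 0\<close>, in agreement with \<open>a_dec d j = 0\<close>.\<close>

definition control_of ::
  "('i::finite, 'j::finite) slot_params \<Rightarrow> ('i, 'j) decision \<Rightarrow> ('i, 'j) control" where
  "control_of w d =
     ((\<chi> j. a_dec d j / A_par w j), (\<chi> i j. m_dec d i j), (\<chi> i. e_dec d i), (\<chi> i. c_dec d i),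
      (\<chi> i. d_dec d i), (\<chi> i k. u_dec d i k))"

definition plausible :: "('i, 'j) slot_params \<Rightarrow> bool" where
  "plausible w \<longleftrightarrow> (\<forall>j. A_par w j \<ge> 0) \<and>
     (\<forall>i. z_par w i \<ge> 0 \<and> pb_par w i \<ge> ps_par w i \<and> ps_par w i > 0)"

definition controls :: "('i::finite, 'j::finite) network \<Rightarrow> ('i, 'j) control set" where
  "controls N = {k. \<forall>w. plausible w \<longrightarrow> slot_feasible N w (decision_of w k)}"

definition penalty ::
  "('i::finite, 'j::finite) network \<Rightarrow> real \<Rightarrow> (real^'j) \<times> (real^'i) \<times> (real^'i) \<Rightarrow>
   ('i, 'j) slot_params \<Rightarrow> ('i, 'j) decision \<Rightarrow> real" where
  "penalty N V h w d = h \<bullet> increment N d + V * cost N w d"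

lemma control_of_in_controls:
  fixes N :: "('i::finite, 'j::finite) network"
  assumes "plausible w" "slot_feasible N w d"
  shows "control_of w d \<in> controls N"
proof -
  have \<rho>: "0 \<le> a_dec d j / A_par w j \<and> a_dec d j / A_par w j \<le> 1" for j
    using assms by (auto simp: slot_feasible_def plausible_def divide_le_eq_1 less_le)
  have "0 \<le> a_dec d j / A_par w j * A_par w' j \<and> a_dec d j / A_par w j * A_par w' j \<le> A_par w' j"
    if "plausible w'" for j and w' :: "('i, 'j) slot_params"
    using \<rho>[of j] that mult_right_mono[of "a_dec d j / A_par w j" 1 "A_par w' j"]
    by (simp only: plausible_def mult_nonneg_nonneg mult_1)
  note \<rho>' = this
  have d: "\<forall>j. \<forall>i\<in>OmegaF N j. 0 \<le> m_dec d i j \<and> m_dec d i j \<le> M_ub N i j"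
    "\<forall>i. 0 \<le> e_dec d i \<and> e_dec d i \<le> E_ub N i"
    "\<forall>i. 0 \<le> c_dec d i \<and> c_dec d i \<le> C_ub N i"
    "\<forall>i. 0 \<le> d_dec d i \<and> d_dec d i \<le> D_ub N i"
    "\<forall>i k. k \<noteq> i \<longrightarrow> u_dec d i k + u_dec d k i = 0 \<and>
                      - U_ub N i k \<le> u_dec d i k \<and> u_dec d i k \<le> U_ub N i k"
    "\<forall>i. u_dec d i i = 0"
    using assms(2) unfolding slot_feasible_def by - ((elim conjE, assumption)+)
  have "slot_feasible N w' (decision_of w' (control_of w d))"
    if "plausible w'" for w' :: "('i, 'j) slot_params"
  proof -
    let ?d = "decision_of w' (control_of w d)"
    have eq: "m_dec ?d = m_dec d" "e_dec ?d = e_dec d" "c_dec ?d = c_dec d"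
      "d_dec ?d = d_dec d" "u_dec ?d = u_dec d"
      by (simp_all add: control_of_def decision_of_def fun_eq_iff)
    have part: "max 0 v - max 0 (- v) = v" for v :: real
      by (simp add: max_def)
    have bal: "\<forall>i. e_dec d i = x_dec ?d i - y_dec ?d i + d_dec d i - c_dec d i + z_par w' i
        + (\<Sum>k\<in>UNIV - {i}. u_dec d i k)"
      by (simp add: control_of_def decision_of_def part del: minus_diff_eq)
    have xy: "\<forall>i. 0 \<le> x_dec ?d i \<and> 0 \<le> y_dec ?d i"
      by (simp add: decision_of_def case_prod_beta)
    have a: "\<forall>j. 0 \<le> a_dec ?d j \<and> a_dec ?d j \<le> A_par w' j"
      using \<rho>'[OF that] by (simp add: control_of_def decision_of_def)
    show ?thesis
      unfolding slot_feasible_def eq using d bal xy a by (intro conjI)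
  qed
  then show ?thesis
    by (simp add: controls_def)
qed

text \<open>Buying and selling at the same time wastes the spread between the two prices on the smaller of the
two amounts.\<close>

lemma spread_cost_le:
  fixes p q x y :: real
  assumes "0 \<le> x" "0 \<le> y" "q \<le> p" "0 < q"
  shows "p * max 0 (x - y) - q * max 0 (- (x - y)) \<le> p * x - q * y"
proof -
  have "p * max 0 (x - y) - q * max 0 (- (x - y)) = p * x - q * y - (p - q) * min x y"
    by (auto simp: max_def min_def algebra_simps)
  moreover have "0 \<le> (p - q) * min x y"
    using assms by simp
  ultimately show ?thesis by linarith
qed

lemma penalty_decision_of_control_of_le:
  assumes w: "plausible w" and d: "slot_feasible N w d" and V: "0 \<le> V"
  shows "penalty N V h w (decision_of w (control_of w d)) \<le> penalty N V h w d"
proof -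
  let ?d = "decision_of w (control_of w d)"
  have a: "a_dec d j / A_par w j * A_par w j = a_dec d j" for j
    using d by (auto simp: slot_feasible_def) (metis order_antisym)
  have "e_dec d i - d_dec d i + c_dec d i - z_par w i - (\<Sum>k\<in>UNIV - {i}. u_dec d i k)
      = x_dec d i - y_dec d i" for i
    using d by (simp add: slot_feasible_def)
  then have xy: "x_dec ?d i = max 0 (x_dec d i - y_dec d i)" "y_dec ?d i = max 0 (- (x_dec d i - y_dec d i))"
    for i
    by (simp_all add: control_of_def decision_of_def del: minus_diff_eq)
  have "increment N ?d = increment N d"
    using a by (simp add: control_of_def decision_of_def increment_def)
  moreover have "cost N w ?d \<le> cost N w d"
  proof -
    have "pb_par w i * x_dec ?d i - ps_par w i * y_dec ?d i \<le> pb_par w i * x_dec d i - ps_par w i * y_dec d i"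
      for i
      unfolding xy using w d by (intro spread_cost_le) (auto simp: slot_feasible_def plausible_def)
    then show ?thesis
      unfolding cost_def
      by (intro add_mono sum_mono) (simp_all add: control_of_def decision_of_def a[simplified])
  qed
  ultimately show ?thesis
    using V by (simp add: penalty_def mult_left_mono)
qed

text \<open>Continuity in the control allows the infimum to be taken over a countable set; continuity in the
state and the parameters makes that infimum measurable.\<close>

lemma continuous_penalty:
  "continuous_on UNIV (\<lambda>((h, v), k). penalty N V h (params_of v) (decision_of (params_of v) k))"
  unfolding penalty_def increment_def cost_def params_of_def decision_of_def case_prod_beta
    slot_params.simps decision.simps
  by (intro continuous_intros continuous_on_max)

lemma increment_measurable:
  assumes "measurable_decision F d"
  shows "(\<lambda>\<omega>. increment N (d \<omega>)) \<in> borel_measurable F"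
  using assms unfolding increment_def measurable_decision_def
  by (intro borel_measurable_Pair borel_measurable_vec_lambda borel_measurable_diff
      borel_measurable_sum borel_measurable_times borel_measurable_const) auto

definition dense_controls :: "('i::finite, 'j::finite) network \<Rightarrow> ('i, 'j) control set" where
  "dense_controls N = (SOME D. countable D \<and> D \<subseteq> controls N \<and> controls N \<subseteq> closure D)"

lemma dense_controls:
  "countable (dense_controls N)" "dense_controls N \<subseteq> controls N"
  "controls N \<subseteq> closure (dense_controls N)"
proof -
  have "\<exists>D. countable D \<and> D \<subseteq> controls N \<and> controls N \<subseteq> closure D"
    using separable[of "controls N"] by metis
  from someI_ex[OF this] show "countable (dense_controls N)" "dense_controls N \<subseteq> controls N"
    "controls N \<subseteq> closure (dense_controls N)"
    by (auto simp: dense_controls_def)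
qed

text \<open>The optimal value of P2 in terms of the virtual queues \<open>h\<close> and the parameters \<open>v\<close>. The infimum is
taken over countably many controls because a countable infimum of Borel functions is Borel, and the
use of independence below requires measurability in \<open>(h, v)\<close>; that it is the value of P2 is the content of
\<open>le_slot_value\<close> and \<open>slot_value_le\<close>.\<close>

definition slot_value ::
  "('i::finite, 'j::finite) network \<Rightarrow> real \<Rightarrow> (real^'j) \<times> (real^'i) \<times> (real^'i) \<Rightarrow>
   (real^'j) \<times> (real^'i) \<times> (real^'i) \<times> (real^'i) \<Rightarrow> real" where
  "slot_value N V h v =
     (INF k\<in>dense_controls N. penalty N V h (params_of v) (decision_of (params_of v) k))"

lemma slot_value_measurable:
  "(\<lambda>(h, v). slot_value N V h v) \<in> borel_measurable (borel \<Otimes>\<^sub>M borel)"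
proof -
  have "(\<lambda>(h, v). penalty N V h (params_of v) (decision_of (params_of v) k)) \<in> borel_measurable borel" for k
    using continuous_on_compose2[OF continuous_penalty[of N V], of UNIV "\<lambda>x. (x, k)"]
    by (intro borel_measurable_continuous_onI) (simp add: continuous_intros case_prod_beta)
  then show ?thesis
    unfolding slot_value_def borel_prod case_prod_beta
    by (intro borel_measurable_cINF_real dense_controls(1)) simp
qed

text \<open>Rejecting all workload and selling the whole PV generation leaves every state unchanged. The
decision serves as the witness that feasible decisions exist, as an upper bound for the value of P2,
and as a feasible policy for P1.\<close>

definition idle_decision :: "('i, 'j) slot_params \<Rightarrow> ('i, 'j) decision" where
  "idle_decision w = \<lparr>a_dec = (\<lambda>_. 0), m_dec = (\<lambda>_ _. 0), e_dec = (\<lambda>_. 0), x_dec = (\<lambda>_. 0),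
     y_dec = z_par w, c_dec = (\<lambda>_. 0), d_dec = (\<lambda>_. 0), u_dec = (\<lambda>_ _. 0)\<rparr>"

lemma idle_decision_feasible:
  assumes "valid_network N" "plausible w"
  shows "slot_feasible N w (idle_decision w)"
  using assms by (auto simp: slot_feasible_def idle_decision_def valid_network_def plausible_def)

lemma increment_idle [simp]: "increment N (idle_decision w) = 0"
  by (simp add: increment_def idle_decision_def vec_eq_iff prod_eq_iff)

lemma cost_idle:
  "cost N w (idle_decision w) = (\<Sum>j\<in>UNIV. gam N j * A_par w j) - (\<Sum>i\<in>UNIV. ps_par w i * z_par w i)"
  by (simp add: cost_def idle_decision_def sum_negf)

lemma dense_controls_nonempty:
  assumes "valid_network N"
  shows "dense_controls N \<noteq> {}"
proof -
  define w :: "('a, 'b) slot_params" where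
    "w = \<lparr>A_par = (\<lambda>_. 0), z_par = (\<lambda>_. 0), pb_par = (\<lambda>_. 1), ps_par = (\<lambda>_. 1)\<rparr>"
  have "plausible w"
    by (simp add: w_def plausible_def)
  then have "control_of w (idle_decision w) \<in> controls N"
    using idle_decision_feasible[OF assms] control_of_in_controls by blast
  then show ?thesis
    using dense_controls(3)[of N] by auto
qed

lemma le_slot_value:
  assumes "valid_network N" and w: "plausible w"
    and "\<And>d. slot_feasible N w d \<Longrightarrow> c \<le> penalty N V h w d"
  shows "c \<le> slot_value N V h (slot_vec w)"
  unfolding slot_value_def params_of_slot_vec
proof (rule cINF_greatest[OF dense_controls_nonempty[OF assms(1)]])
  fix k assume "k \<in> dense_controls N"
  then have "slot_feasible N w (decision_of w k)"
    using dense_controls(2)[of N] w by (auto simp: controls_def)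
  then show "c \<le> penalty N V h w (decision_of w k)"
    by (rule assms(3))
qed

text \<open>Selling is the only source of revenue, and the energy that can be sold comes from discharging, from
PV generation and from other back ends, each of which is limited. Buying cannot make this worse,
since the buying price is at least the selling price.\<close>

lemma cost_ge:
  assumes net: "valid_network N" and w: "plausible w" and d: "slot_feasible N w d"
  shows "- (\<Sum>i\<in>UNIV. ps_par w i * (D_ub N i + z_par w i + (\<Sum>k\<in>UNIV - {i}. U_ub N i k))) \<le> cost N w d"
proof -
  have "- (ps_par w i * (D_ub N i + z_par w i + (\<Sum>k\<in>UNIV - {i}. U_ub N i k)))
      \<le> pb_par w i * x_dec d i - ps_par w i * y_dec d i + bet N i * (c_dec d i + d_dec d i)" for i
  proof -
    have "(\<Sum>k\<in>UNIV - {i}. u_dec d i k) \<le> (\<Sum>k\<in>UNIV - {i}. U_ub N i k)"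
      using d by (intro sum_mono) (auto simp: slot_feasible_def)
    moreover have "e_dec d i = x_dec d i - y_dec d i + d_dec d i - c_dec d i + z_par w i
                      + (\<Sum>k\<in>UNIV - {i}. u_dec d i k)"
        "0 \<le> e_dec d i" "0 \<le> c_dec d i" "d_dec d i \<le> D_ub N i" "0 \<le> d_dec d i" "0 \<le> x_dec d i"
      using d by (auto simp: slot_feasible_def)
    ultimately have "- (D_ub N i + z_par w i + (\<Sum>k\<in>UNIV - {i}. U_ub N i k)) \<le> x_dec d i - y_dec d i"
      by linarith
    then have "ps_par w i * - (D_ub N i + z_par w i + (\<Sum>k\<in>UNIV - {i}. U_ub N i k))
        \<le> ps_par w i * (x_dec d i - y_dec d i)"
      using w by (intro mult_left_mono) (auto simp: plausible_def less_imp_le)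
    moreover have "ps_par w i * x_dec d i \<le> pb_par w i * x_dec d i"
      using w \<open>0 \<le> x_dec d i\<close> by (intro mult_right_mono) (auto simp: plausible_def)
    moreover have "0 \<le> bet N i * (c_dec d i + d_dec d i)"
      using net \<open>0 \<le> c_dec d i\<close> \<open>0 \<le> d_dec d i\<close> by (simp add: valid_network_def)
    ultimately show ?thesis
      by (simp only: right_diff_distrib mult_minus_right)
  qed
  moreover have "0 \<le> (\<Sum>i\<in>OmegaF N j. alpha N i j * m_dec d i j) + gam N j * (A_par w j - a_dec d j)" for j
    using net d
    by (intro add_nonneg_nonneg sum_nonneg mult_nonneg_nonneg)
      (auto simp: valid_network_def slot_feasible_def less_imp_le)
  ultimately have "(\<Sum>i\<in>UNIV. - (ps_par w i * (D_ub N i + z_par w i + (\<Sum>k\<in>UNIV - {i}. U_ub N i k)))) + 0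
     \<le> cost N w d"
    unfolding cost_def by (intro add_mono sum_mono sum_nonneg) auto
  then show ?thesis
    by (simp add: sum_negf)
qed

lemma inner_increment_bound:
  assumes "(norm x)\<^sup>2 \<le> 2 * K"
  shows "\<bar>h \<bullet> x\<bar> \<le> norm h * sqrt (2 * K)"
  using Cauchy_Schwarz_ineq2[of h x] real_le_rsqrt[OF assms]
    mult_left_mono[of "norm x" "sqrt (2 * K)" "norm h"] by simp

lemma penalty_ge:
  assumes net: "valid_network N" and w: "plausible w" and d: "slot_feasible N w d"
    and A: "\<And>j. (A_par w j)\<^sup>2 \<le> A_sq_max M W j" and V: "0 \<le> V"
  shows "- (norm h * sqrt (2 * (N1 M W N + N2 N + N3 N))
      + V * (\<Sum>i\<in>UNIV. ps_par w i * (D_ub N i + z_par w i + (\<Sum>k\<in>UNIV - {i}. U_ub N i k))))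
     \<le> penalty N V h w d"
  using inner_increment_bound[OF norm_increment_le[OF net d A], of h]
    mult_left_mono[OF cost_ge[OF net w d] V]
  by (simp add: penalty_def abs_le_iff)

text \<open>A feasible decision is matched by a control, which is a limit of controls of the dense set; the
inequality survives the limit because the penalty is continuous in the control.\<close>

lemma slot_value_le:
  fixes N :: "('i::finite, 'j::finite) network"
    and W :: "nat \<Rightarrow> 'w \<Rightarrow> ('i, 'j) slot_params"
  assumes net: "valid_network N" and w: "plausible w" and d: "slot_feasible N w d"
    and A: "\<And>j. (A_par w j)\<^sup>2 \<le> A_sq_max M W j" and V: "0 \<le> V"
  shows "slot_value N V h (slot_vec w) \<le> penalty N V h w d"
proof -
  let ?f = "\<lambda>k. penalty N V h w (decision_of w k)"
  have cont: "continuous_on UNIV ?f"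
    using continuous_on_compose2[OF continuous_penalty[of N V], of UNIV "\<lambda>k. ((h, slot_vec w), k)"]
    by (simp add: continuous_intros)
  have feas: "slot_feasible N w (decision_of w k)" if "k \<in> dense_controls N" for k
    using dense_controls(2)[of N] w that by (auto simp: controls_def)
  have "bdd_below (?f ` dense_controls N)"
    by (rule bdd_belowI2) (rule penalty_ge[OF net w feas A V])
  then have "dense_controls N \<subseteq> {k. slot_value N V h (slot_vec w) \<le> ?f k}"
    unfolding slot_value_def params_of_slot_vec by (auto intro: cINF_lower)
  moreover have "closed {k. slot_value N V h (slot_vec w) \<le> ?f k}"
    using cont by (intro closed_Collect_le continuous_intros)
  ultimately have "controls N \<subseteq> {k. slot_value N V h (slot_vec w) \<le> ?f k}"
    using dense_controls(3)[of N] closure_minimal by blast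
  then have "slot_value N V h (slot_vec w) \<le> ?f (control_of w d)"
    using control_of_in_controls[OF w d] by auto
  also have "\<dots> \<le> penalty N V h w d"
    by (rule penalty_decision_of_control_of_le[OF w d V])
  finally show ?thesis .
qed


section \<open>The random system\<close>

lemma bdd_above_uniform:
  assumes "bdd_above ((\<lambda>(t, \<omega>). f t \<omega> :: real) ` ({1::nat..} \<times> S))"
  shows "\<exists>B. \<forall>t\<ge>1. \<forall>\<omega>\<in>S. f t \<omega> \<le> B"
proof -
  obtain B where "\<forall>x\<in>(\<lambda>(t, \<omega>). f t \<omega>) ` ({1..} \<times> S). x \<le> B"
    using assms unfolding bdd_above_def by blast
  then show ?thesis
    by (intro exI[of _ B]) force
qed

locale iid_system = prob_space M
  for M :: "'w measure" +
  fixes N :: "('i::finite, 'j::finite) network"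
    and W :: "nat \<Rightarrow> 'w \<Rightarrow> ('i, 'j) slot_params"
    and V :: real
  assumes network: "valid_network N"
    and params: "valid_params M W"
    and iid: "iid_params M W"
    and V_pos: "0 < V"
begin

abbreviation gap :: real where
  "gap \<equiv> N1 M W N + N2 N + N3 N"

abbreviation val :: "(real^'j) \<times> (real^'i) \<times> (real^'i) \<Rightarrow> nat \<Rightarrow> 'w \<Rightarrow> real" where
  "val h t \<omega> \<equiv> slot_value N V h (slot_vec (W t \<omega>))"

lemma plausible_params: "1 \<le> t \<Longrightarrow> \<omega> \<in> space M \<Longrightarrow> plausible (W t \<omega>)"
  using params by (simp add: valid_params_def plausible_def)

lemma arrival_square_le:
  assumes "1 \<le> t" "\<omega> \<in> space M"
  shows "(A_par (W t \<omega>) j)\<^sup>2 \<le> A_sq_max M W j"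
proof -
  have "bdd_above ((\<lambda>(t, \<omega>). A_par (W t \<omega>) j) ` ({1..} \<times> space M))"
    using params by (simp add: valid_params_def)
  from bdd_above_uniform[OF this] obtain B
    where B: "A_par (W t \<omega>) j \<le> B" if "1 \<le> t" "\<omega> \<in> space M" for t \<omega>
    by blast
  have "(A_par (W t \<omega>) j)\<^sup>2 \<le> B\<^sup>2" if "1 \<le> t" "\<omega> \<in> space M" for t \<omega>
    using B[rule_format, OF that] plausible_params[OF that] by (intro power_mono) (auto simp: plausible_def)
  then have "bdd_above ((\<lambda>(t, \<omega>). (A_par (W t \<omega>) j)\<^sup>2) ` ({1..} \<times> space M))"
    by (intro bdd_aboveI[of _ "B\<^sup>2"]) auto
  from cSUP_upper[OF _ this, of "(t, \<omega>)"] show ?thesis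
    using assms by (simp add: A_sq_max_def)
qed

lemma increment_le:
  assumes "1 \<le> t" "\<omega> \<in> space M" "slot_feasible N (W t \<omega>) d"
  shows "(norm (increment N d))\<^sup>2 \<le> 2 * gap"
  using norm_increment_le[OF network assms(3) arrival_square_le[OF assms(1,2)]] .

lemma gap_nonneg: "0 \<le> gap"
proof -
  obtain \<omega> where \<omega>: "\<omega> \<in> space M"
    using not_empty by blast
  have "0 \<le> (norm (increment N (idle_decision (W 1 \<omega>))))\<^sup>2"
    by simp
  also have "\<dots> \<le> 2 * gap"
    by (intro increment_le[of 1 \<omega>] idle_decision_feasible network plausible_params \<omega>) simp_all
  finally show ?thesis by simp
qed

lemma slot_vec_measurable:
  assumes "1 \<le> t"
  shows "(\<lambda>\<omega>. slot_vec (W t \<omega>)) \<in> borel_measurable M"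
  using iid assms by (auto simp: iid_params_def indep_vars_def)

lemma params_measurable:
  assumes "(\<lambda>\<omega>. slot_vec (W t \<omega>)) \<in> borel_measurable F"
  shows "(\<lambda>\<omega>. A_par (W t \<omega>) j) \<in> borel_measurable F" "(\<lambda>\<omega>. z_par (W t \<omega>) i) \<in> borel_measurable F"
    "(\<lambda>\<omega>. ps_par (W t \<omega>) i) \<in> borel_measurable F"
proof -
  let ?v = "\<lambda>\<omega>. slot_vec (W t \<omega>)"
  have "(\<lambda>\<omega>. fst (?v \<omega>) $ j) \<in> borel_measurable F"
    "(\<lambda>\<omega>. fst (snd (?v \<omega>)) $ i) \<in> borel_measurable F"
    "(\<lambda>\<omega>. snd (snd (snd (?v \<omega>))) $ i) \<in> borel_measurable F"
    by (auto intro!: measurable_compose[OF assms] borel_measurable_continuous_onI continuous_intros)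
  then show "(\<lambda>\<omega>. A_par (W t \<omega>) j) \<in> borel_measurable F" "(\<lambda>\<omega>. z_par (W t \<omega>) i) \<in> borel_measurable F"
    "(\<lambda>\<omega>. ps_par (W t \<omega>) i) \<in> borel_measurable F"
    by (simp_all add: slot_vec_def)
qed

lemma price_bound: "\<exists>B. \<forall>i. \<forall>t\<ge>1. \<forall>\<omega>\<in>space M. pb_par (W t \<omega>) i \<le> B i"
proof -
  have "bdd_above ((\<lambda>(t, \<omega>). pb_par (W t \<omega>) i) ` ({1..} \<times> space M))" for i
    using params by (simp add: valid_params_def)
  then have "\<forall>i. \<exists>B. \<forall>t\<ge>1. \<forall>\<omega>\<in>space M. pb_par (W t \<omega>) i \<le> B"
    by (intro allI bdd_above_uniform)
  from choice[OF this] show ?thesis .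
qed

lemma request_bound: "\<exists>G. \<forall>j. \<forall>t\<ge>1. \<forall>\<omega>\<in>space M. A_par (W t \<omega>) j \<le> G j"
proof -
  have "bdd_above ((\<lambda>(t, \<omega>). A_par (W t \<omega>) j) ` ({1..} \<times> space M))" for j
    using params by (simp add: valid_params_def)
  then have "\<forall>j. \<exists>G. \<forall>t\<ge>1. \<forall>\<omega>\<in>space M. A_par (W t \<omega>) j \<le> G"
    by (intro allI bdd_above_uniform)
  from choice[OF this] show ?thesis .
qed

text \<open>The value of P2 is dominated by an integrable random variable that depends on the virtual queues only
through their norm: the drift is controlled by the Cauchy-Schwarz inequality, the cost from below by
the largest possible revenue and from above by the cost of idling.\<close>

lemma value_bound:
  "\<exists>c b. \<forall>t\<ge>1. \<forall>\<omega>\<in>space M. \<forall>h.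
     \<bar>val h t \<omega>\<bar> \<le> norm h * sqrt (2 * gap) + (c + (\<Sum>i\<in>UNIV. b i * z_par (W t \<omega>) i))"
proof -
  from price_bound obtain B where B: "\<forall>i. \<forall>t\<ge>1. \<forall>\<omega>\<in>space M. pb_par (W t \<omega>) i \<le> B i"
    by (elim exE)
  from request_bound obtain G where G: "\<forall>j. \<forall>t\<ge>1. \<forall>\<omega>\<in>space M. A_par (W t \<omega>) j \<le> G j"
    by (elim exE)
  define Q where "Q i = D_ub N i + (\<Sum>k\<in>UNIV - {i}. U_ub N i k)" for i
  have Q: "0 \<le> Q i" for i
    using network by (auto simp: Q_def valid_network_def intro!: add_nonneg_nonneg sum_nonneg)
  define c where "c = V * (\<Sum>i\<in>UNIV. B i * Q i) + V * (\<Sum>j\<in>UNIV. gam N j * G j)"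
  have "\<bar>val h t \<omega>\<bar> \<le> norm h * sqrt (2 * gap) + (c + (\<Sum>i\<in>UNIV. V * B i * z_par (W t \<omega>) i))"
    if t: "1 \<le> t" and \<omega>: "\<omega> \<in> space M" for t \<omega> h
  proof -
    let ?w = "W t \<omega>"
    note w = plausible_params[OF t \<omega>]
    have B': "0 \<le> ps_par ?w i" "ps_par ?w i \<le> B i" "0 \<le> B i" "0 \<le> z_par ?w i"
      for i
    proof -
      have "0 < ps_par ?w i" "ps_par ?w i \<le> pb_par ?w i" "0 \<le> z_par ?w i"
        using w by (auto simp: plausible_def)
      with B[rule_format, OF t \<omega>, of i]
      show "0 \<le> ps_par ?w i" "ps_par ?w i \<le> B i" "0 \<le> B i" "0 \<le> z_par ?w i" by linarith+
    qed
    have G': "0 \<le> gam N j * A_par ?w j" "gam N j * A_par ?w j \<le> gam N j * G j" for j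
      using w network G[rule_format, OF t \<omega>, of j]
      by (auto simp: plausible_def valid_network_def less_imp_le intro!: mult_left_mono)
    have G0: "0 \<le> (\<Sum>j\<in>UNIV. gam N j * G j)"
      by (intro sum_nonneg order_trans[OF G'])
    have B0: "0 \<le> (\<Sum>i\<in>UNIV. B i * Q i)" "0 \<le> (\<Sum>i\<in>UNIV. B i * z_par ?w i)"
      by (auto intro!: sum_nonneg mult_nonneg_nonneg B' Q)
    have "- (norm h * sqrt (2 * gap) + V * (\<Sum>i\<in>UNIV. ps_par ?w i * (D_ub N i + z_par ?w i + (\<Sum>k\<in>UNIV - {i}. U_ub N i k))))
        \<le> val h t \<omega>"
      using V_pos by (intro le_slot_value[OF network w] penalty_ge[OF network w _ arrival_square_le[OF t \<omega>]]) auto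
    moreover have "(\<Sum>i\<in>UNIV. ps_par ?w i * (D_ub N i + z_par ?w i + (\<Sum>k\<in>UNIV - {i}. U_ub N i k)))
        \<le> (\<Sum>i\<in>UNIV. B i * (Q i + z_par ?w i))"
    proof (intro sum_mono mult_mono)
      fix i show "0 \<le> D_ub N i + z_par ?w i + (\<Sum>k\<in>UNIV - {i}. U_ub N i k)"
        using Q[of i] B'(4)[of i] by (simp add: Q_def)
    qed (auto simp: Q_def B')
    then have "V * (\<Sum>i\<in>UNIV. ps_par ?w i * (D_ub N i + z_par ?w i + (\<Sum>k\<in>UNIV - {i}. U_ub N i k)))
        \<le> V * (\<Sum>i\<in>UNIV. B i * (Q i + z_par ?w i))"
      using V_pos by (intro mult_left_mono) auto
    moreover have "val h t \<omega> \<le> penalty N V h ?w (idle_decision ?w)"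
      using V_pos by (intro slot_value_le[OF network w idle_decision_feasible[OF network w] arrival_square_le[OF t \<omega>]]) auto
    moreover have "cost N ?w (idle_decision ?w) \<le> (\<Sum>j\<in>UNIV. gam N j * G j)"
      using sum_mono[of UNIV "\<lambda>j. gam N j * A_par ?w j", OF G'(2)] sum_nonneg[of UNIV "\<lambda>i. ps_par ?w i * z_par ?w i"] B'
      by (simp add: cost_idle)
    then have "penalty N V h ?w (idle_decision ?w) \<le> V * (\<Sum>j\<in>UNIV. gam N j * G j)"
      using V_pos by (simp add: penalty_def)
    moreover have "0 \<le> norm h * sqrt (2 * gap)"
      using gap_nonneg by simp
    moreover have "0 \<le> V * (\<Sum>j\<in>UNIV. gam N j * G j)" "0 \<le> V * (\<Sum>i\<in>UNIV. B i * Q i)"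
      "0 \<le> V * (\<Sum>i\<in>UNIV. B i * z_par ?w i)"
      using V_pos G0 B0 by auto
    ultimately show ?thesis
      by (simp add: c_def abs_le_iff distrib_left sum.distrib sum_distrib_left mult.assoc)
  qed
  then show ?thesis
    by (intro exI[of _ c] exI[of _ "\<lambda>i. V * B i"]) blast
qed

lemma value_measurable:
  assumes "1 \<le> t" "H \<in> borel_measurable M"
  shows "(\<lambda>\<omega>. val (H \<omega>) t \<omega>) \<in> borel_measurable M"
  using measurable_compose[OF measurable_Pair[OF assms(2) slot_vec_measurable[OF assms(1)]]
      slot_value_measurable] by simp

lemma integrable_value:
  assumes t: "1 \<le> t" and H: "H \<in> borel_measurable M" "\<And>\<omega>. \<omega> \<in> space M \<Longrightarrow> norm (H \<omega>) \<le> R"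
  shows "integrable M (\<lambda>\<omega>. val (H \<omega>) t \<omega>)"
proof -
  from value_bound obtain c b where cb: "\<forall>t\<ge>1. \<forall>\<omega>\<in>space M. \<forall>h.
      \<bar>val h t \<omega>\<bar> \<le> norm h * sqrt (2 * gap) + (c + (\<Sum>i\<in>UNIV. b i * z_par (W t \<omega>) i))"
    by (elim exE)
  have "integrable M (\<lambda>\<omega>. R * sqrt (2 * gap) + (c + (\<Sum>i\<in>UNIV. b i * z_par (W t \<omega>) i)))"
    using params t by (auto simp: valid_params_def)
  then show ?thesis
  proof (rule Bochner_Integration.integrable_bound[OF _ value_measurable[OF t H(1)]], intro AE_I2)
    fix \<omega> assume \<omega>: "\<omega> \<in> space M"
    have "norm (H \<omega>) * sqrt (2 * gap) \<le> R * sqrt (2 * gap)"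
      using H(2)[OF \<omega>] gap_nonneg by (intro mult_right_mono) auto
    with cb[rule_format, OF t \<omega>, of "H \<omega>"]
    show "norm (val (H \<omega>) t \<omega>) \<le> norm (R * sqrt (2 * gap) + (c + (\<Sum>i\<in>UNIV. b i * z_par (W t \<omega>) i)))"
      by simp
  qed
qed


section \<open>The value of P2 at frozen virtual queues\<close>

text \<open>The expected value of P2 when the virtual queues are held at the constant \<open>h\<close>. Since the slots are
identically distributed it is the same in all slots.\<close>

definition expected_value :: "(real^'j) \<times> (real^'i) \<times> (real^'i) \<Rightarrow> real" where
  "expected_value h = (LINT v|distr M borel (\<lambda>\<omega>. slot_vec (W 1 \<omega>)). slot_value N V h v)"

lemma slot_value_measurable_snd: "slot_value N V h \<in> borel_measurable borel"
  using measurable_compose[OF measurable_Pair1' slot_value_measurable[of N V], of h] by simp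

lemma distr_slot_vec:
  assumes "1 \<le> t"
  shows "distr M borel (\<lambda>\<omega>. slot_vec (W t \<omega>)) = distr M borel (\<lambda>\<omega>. slot_vec (W 1 \<omega>))"
  using iid assms unfolding iid_params_def by blast

lemma expectation_value:
  assumes "1 \<le> t"
  shows "(LINT \<omega>|M. val h t \<omega>) = expected_value h"
  unfolding expected_value_def distr_slot_vec[OF assms, symmetric]
  by (rule integral_distr[symmetric, OF slot_vec_measurable[OF assms] slot_value_measurable_snd])


section \<open>Information and independence\<close>

lemma slot_vec_measurable_info:
  assumes "t \<in> S"
  shows "(\<lambda>\<omega>. slot_vec (W t \<omega>)) \<in> borel_measurable (info M W S)"
proof -
  have "(\<lambda>\<omega>. \<lambda>s\<in>S. slot_vec (W s \<omega>)) \<in> info M W S \<rightarrow>\<^sub>M PiM S (\<lambda>_. borel)"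
    unfolding info_def by (rule measurable_vimage_algebra1) (auto simp: space_PiM)
  from measurable_compose[OF this measurable_component_singleton[OF assms]] show ?thesis
    using assms by simp
qed

lemma space_info [simp]: "space (info M W S) = space M"
  by (simp add: info_def)

lemma sets_info_subset:
  assumes "space F = space M"
    and "\<And>t. t \<in> S \<Longrightarrow> (\<lambda>\<omega>. slot_vec (W t \<omega>)) \<in> borel_measurable F"
  shows "sets (info M W S) \<subseteq> sets F"
  unfolding info_def
  by (rule sets_image_in_sets, rule assms(1), rule measurable_restrict, rule assms(2))

lemma measurable_info_mono:
  assumes "f \<in> borel_measurable (info M W S)" "S \<subseteq> S'"
  shows "f \<in> borel_measurable (info M W S')"
proof (rule measurable_from_subalg[OF _ assms(1)])
  show "subalgebra (info M W S') (info M W S)"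
    unfolding subalgebra_def using assms(2)
    by (intro conjI sets_info_subset slot_vec_measurable_info) auto
qed

lemma measurable_from_info:
  assumes "f \<in> borel_measurable (info M W S)" "S \<subseteq> {1..}"
  shows "f \<in> borel_measurable M"
proof (rule measurable_from_subalg[OF _ assms(1)])
  show "subalgebra M (info M W S)"
    unfolding subalgebra_def using assms(2)
    by (intro conjI sets_info_subset slot_vec_measurable) auto
qed

text \<open>Random variables determined by the parameters of disjoint sets of slots are independent, because the
parameters of different slots are.\<close>

lemma indep_var_info:
  assumes X: "X \<in> borel_measurable (info M W S)" and Y: "Y \<in> borel_measurable (info M W S')"
    and S: "S \<subseteq> {1..}" "S' \<subseteq> {1..}" "S \<inter> S' = {}"
  shows "indep_var borel X borel Y"
proof -
  let ?R = "\<lambda>S \<omega>. \<lambda>s\<in>S. slot_vec (W s \<omega>)"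
  have info: "sigma_sets (space M) {?R S -` A \<inter> space M |A. A \<in> sets (PiM S (\<lambda>_. borel))} = sets (info M W S)" for S
    by (simp add: info_def sets_vimage_algebra)
  have "indep_vars (\<lambda>_. borel) (\<lambda>t \<omega>. slot_vec (W t \<omega>)) {1..}"
    using iid by (simp add: iid_params_def)
  then have "indep_var (PiM S (\<lambda>_. borel)) (?R S) (PiM S' (\<lambda>_. borel)) (?R S')"
    using indep_var_restrict[OF _ S(3,1,2)] by blast
  then have ind: "indep_set (sets (info M W S)) (sets (info M W S'))"
    unfolding indep_var_eq info by blast
  have sub: "sigma_sets (space M) {X -` A \<inter> space M |A. A \<in> sets borel} \<subseteq> sets (info M W S)"
    if "X \<in> borel_measurable (info M W S)" for X :: "'w \<Rightarrow> 'c::topological_space" and S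
    using sets.sigma_sets_subset[of "{X -` A \<inter> space M |A. A \<in> sets borel}" "info M W S"]
      measurable_sets[OF that] by auto
  have "indep_set (sigma_sets (space M) {X -` A \<inter> space M |A. A \<in> sets borel})
      (sigma_sets (space M) {Y -` A \<inter> space M |A. A \<in> sets borel})"
    using sub[OF X] sub[OF Y] unfolding indep_set_def
    by (intro indep_sets_mono_sets[OF ind[unfolded indep_set_def]]) (auto split: bool.split)
  then show ?thesis
    using measurable_from_info[OF X S(1)] measurable_from_info[OF Y S(2)] by (simp add: indep_var_eq)
qed


section \<open>Comparison with offline policies\<close>

text \<open>P1 admits a policy with a long-run average cost, so that \<open>P1_value\<close> is the infimum of a nonempty
set: under idling all slots have the same expected cost.\<close>

lemma idle_policy:
  "P1_feasible M W N (\<lambda>t \<omega>. idle_decision (W t \<omega>))"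
  "\<exists>F. long_run_cost M W N (\<lambda>t \<omega>. idle_decision (W t \<omega>)) F"
proof -
  have state: "state_at N (\<lambda>\<tau>. idle_decision (W \<tau> \<omega>)) t = init_state N" for \<omega> t
    by (induction t) (simp_all add: next_state_def idle_decision_def init_state_def)
  let ?c = "\<lambda>v. cost N (params_of v) (idle_decision (params_of v)) :: real"
  have c: "?c \<in> borel_measurable borel"
    unfolding cost_idle params_of_def slot_params.simps
    by (intro borel_measurable_continuous_onI continuous_intros)
  have cost_int: "integrable M (\<lambda>\<omega>. cost N (W t \<omega>) (idle_decision (W t \<omega>)))" if t: "1 \<le> t" for t
  proof -
    from price_bound obtain B where B: "\<forall>i. \<forall>t\<ge>1. \<forall>\<omega>\<in>space M. pb_par (W t \<omega>) i \<le> B i"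
      by (elim exE)
    from request_bound obtain G where G: "\<forall>j. \<forall>t\<ge>1. \<forall>\<omega>\<in>space M. A_par (W t \<omega>) j \<le> G j"
      by (elim exE)
    note meas = params_measurable[OF slot_vec_measurable[OF t]]
    have A: "integrable M (\<lambda>\<omega>. A_par (W t \<omega>) j)" for j
      using G[rule_format, OF t] plausible_params[OF t]
      by (intro integrable_const_bound[of _ "G j"] AE_I2 meas) (auto simp: plausible_def)
    have "integrable M (\<lambda>\<omega>. ps_par (W t \<omega>) i * z_par (W t \<omega>) i)" for i
    proof (rule Bochner_Integration.integrable_bound)
      show "integrable M (\<lambda>\<omega>. B i * z_par (W t \<omega>) i)"
        using params t by (simp add: valid_params_def)
      show "AE \<omega> in M. norm (ps_par (W t \<omega>) i * z_par (W t \<omega>) i) \<le> norm (B i * z_par (W t \<omega>) i)"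
      proof (intro AE_I2)
        fix \<omega> assume "\<omega> \<in> space M"
        then have "0 < ps_par (W t \<omega>) i" "ps_par (W t \<omega>) i \<le> pb_par (W t \<omega>) i" "pb_par (W t \<omega>) i \<le> B i"
          using plausible_params[OF t] B[rule_format, OF t] by (auto simp: plausible_def)
        then show "norm (ps_par (W t \<omega>) i * z_par (W t \<omega>) i) \<le> norm (B i * z_par (W t \<omega>) i)"
          unfolding norm_mult by (intro mult_right_mono) auto
      qed
    qed (intro borel_measurable_times meas)
    with A show ?thesis
      unfolding cost_idle by (intro Bochner_Integration.integrable_diff Bochner_Integration.integrable_sum) auto
  qed
  show "P1_feasible M W N (\<lambda>t \<omega>. idle_decision (W t \<omega>))"
    unfolding P1_feasible_def Let_def state
  proof (intro allI impI conjI ballI)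
    fix t :: nat assume t: "1 \<le> t"
    show "measurable_decision (info M W {1..}) (\<lambda>\<omega>. idle_decision (W t \<omega>))"
      using params_measurable(2)[OF slot_vec_measurable_info[of t "{1..}"]] t
      by (simp add: measurable_decision_def idle_decision_def)
    show "integrable M (\<lambda>\<omega>. cost N (W t \<omega>) (idle_decision (W t \<omega>)))"
      by (rule cost_int[OF t])
    fix \<omega> assume "\<omega> \<in> space M"
    then show "slot_feasible N (W t \<omega>) (idle_decision (W t \<omega>))"
      by (intro idle_decision_feasible network plausible_params t)
  qed (use network in \<open>auto simp: init_state_def valid_network_def\<close>)
  define e where "e = (LINT v|distr M borel (\<lambda>\<omega>. slot_vec (W 1 \<omega>)). ?c v)"
  have e: "(LINT \<omega>|M. cost N (W t \<omega>) (idle_decision (W t \<omega>))) = e"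
    if "1 \<le> t" for t
    unfolding e_def distr_slot_vec[OF that, symmetric]
    using integral_distr[OF slot_vec_measurable[OF that] c] by simp
  have "1 / real T * (\<Sum>t=1..T. (LINT \<omega>|M. cost N (W t \<omega>) (idle_decision (W t \<omega>)))) = e" if "1 \<le> T" for T
    using that by (simp add: e)
  then show "\<exists>F. long_run_cost M W N (\<lambda>t \<omega>. idle_decision (W t \<omega>)) F"
    unfolding long_run_cost_def
    by (intro exI[of _ e] tendsto_eventually eventually_sequentiallyI[of 1])
qed

text \<open>The decision of an offline policy in slot \<open>t\<close> is a candidate for P2 at the frozen virtual queues \<open>h\<close>,
however much of the future it knows, so its expected penalty is at least \<open>expected_value h\<close>. Summed
over the slots, the increments telescope to the difference of two states within the bounds of P1.
Hence the drift is bounded independently of the horizon and vanishes in the average, whatever \<open>h\<close>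
is, and only the cost remains.\<close>

lemma offline_bound:
  assumes feas: "P1_feasible M W N Q" and F: "long_run_cost M W N Q F"
  shows "expected_value h \<le> V * F"
proof -
  let ?X = "\<lambda>t \<omega>. state_vec (state_at N (\<lambda>\<tau>. Q \<tau> \<omega>) t)"
  let ?S = "{0..\<chi> j. QF_ub N j} \<times> {0..\<chi> i. QB_ub N i} \<times> {\<chi> i. B_lb N i..\<chi> i. B_ub N i}"
  have "bounded ?S"
    by (intro bounded_Times compact_imp_bounded compact_interval)
  then obtain R where R: "\<forall>x\<in>?S. norm x \<le> R"
    unfolding bounded_iff by (elim exE)
  have X: "norm (?X t \<omega>) \<le> R" if "1 \<le> t" "\<omega> \<in> space M" for t \<omega>
  proof -
    have "?X t \<omega> \<in> ?S"
      using feas that by (simp add: P1_feasible_def Let_def state_vec_def less_eq_vec_def)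
    with R show ?thesis by (rule bspec)
  qed
  have slot: "slot_feasible N (W t \<omega>) (Q t \<omega>)" if "1 \<le> t" "\<omega> \<in> space M" for t \<omega>
    using feas that by (simp add: P1_feasible_def)
  have cost: "integrable M (\<lambda>\<omega>. cost N (W t \<omega>) (Q t \<omega>))" if "1 \<le> t" for t
    using feas that by (simp add: P1_feasible_def)
  have inc: "integrable M (\<lambda>\<omega>. h \<bullet> increment N (Q t \<omega>))" if t: "1 \<le> t" for t
  proof (rule integrable_const_bound)
    have "measurable_decision (info M W {1..}) (Q t)"
      using feas t by (simp add: P1_feasible_def)
    from measurable_from_info[OF increment_measurable[OF this]]
    show "(\<lambda>\<omega>. h \<bullet> increment N (Q t \<omega>)) \<in> borel_measurable M" by simp
    show "AE \<omega> in M. norm (h \<bullet> increment N (Q t \<omega>)) \<le> norm h * sqrt (2 * gap)"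
    proof (intro AE_I2)
      fix \<omega> assume "\<omega> \<in> space M"
      from inner_increment_bound[OF increment_le[OF t this slot[OF t this]], of h]
      show "norm (h \<bullet> increment N (Q t \<omega>)) \<le> norm h * sqrt (2 * gap)" by simp
    qed
  qed
  have one: "expected_value h \<le> (LINT \<omega>|M. h \<bullet> increment N (Q t \<omega>)) + V * (LINT \<omega>|M. cost N (W t \<omega>) (Q t \<omega>))"
    if t: "1 \<le> t" for t
  proof -
    have "expected_value h = (LINT \<omega>|M. val h t \<omega>)"
      by (rule expectation_value[OF t, symmetric])
    also have "\<dots> \<le> (LINT \<omega>|M. h \<bullet> increment N (Q t \<omega>) + V * cost N (W t \<omega>) (Q t \<omega>))"
    proof (rule integral_mono)
      show "integrable M (val h t)"
        by (rule integrable_value[OF t, of _ "norm h"]) simp_all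
      show "integrable M (\<lambda>\<omega>. h \<bullet> increment N (Q t \<omega>) + V * cost N (W t \<omega>) (Q t \<omega>))"
        using inc[OF t] cost[OF t] by simp
      fix \<omega> assume \<omega>: "\<omega> \<in> space M"
      show "val h t \<omega> \<le> h \<bullet> increment N (Q t \<omega>) + V * cost N (W t \<omega>) (Q t \<omega>)"
        unfolding penalty_def[symmetric] using V_pos
        by (intro slot_value_le[OF network plausible_params[OF t \<omega>] slot[OF t \<omega>] arrival_square_le[OF t \<omega>]]) simp
    qed
    also have "\<dots> = (LINT \<omega>|M. h \<bullet> increment N (Q t \<omega>)) + V * (LINT \<omega>|M. cost N (W t \<omega>) (Q t \<omega>))"
      using inc[OF t] cost[OF t] by simp
    finally show ?thesis .
  qed
  have tele: "(\<Sum>t=1..T. h \<bullet> increment N (Q t \<omega>)) = h \<bullet> (?X (Suc T) \<omega> - ?X 1 \<omega>)" for T \<omega>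
    by (induction T) (simp_all add: state_vec_next_state inner_add_right inner_diff_right)
  have drift: "(\<Sum>t=1..T. (LINT \<omega>|M. h \<bullet> increment N (Q t \<omega>))) \<le> norm h * (2 * R)" for T
  proof -
    have "(\<Sum>t=1..T. (LINT \<omega>|M. h \<bullet> increment N (Q t \<omega>))) = (LINT \<omega>|M. (\<Sum>t=1..T. h \<bullet> increment N (Q t \<omega>)))"
      using inc by (intro Bochner_Integration.integral_sum[symmetric]) auto
    also have "\<dots> \<le> (LINT \<omega>|M. norm h * (2 * R))"
    proof (rule integral_mono)
      show "integrable M (\<lambda>\<omega>. \<Sum>t=1..T. h \<bullet> increment N (Q t \<omega>))"
        using inc by (intro Bochner_Integration.integrable_sum) auto
      fix \<omega> assume \<omega>: "\<omega> \<in> space M"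
      have "norm (?X (Suc T) \<omega> - ?X 1 \<omega>) \<le> 2 * R"
        using X[OF _ \<omega>, of "Suc T"] X[OF _ \<omega>, of 1] norm_triangle_ineq4[of "?X (Suc T) \<omega>" "?X 1 \<omega>"] by simp
      then show "(\<Sum>t=1..T. h \<bullet> increment N (Q t \<omega>)) \<le> norm h * (2 * R)"
        unfolding tele by (rule order_trans[OF norm_cauchy_schwarz mult_left_mono]) simp
    qed simp
    finally show ?thesis by (simp add: prob_space)
  qed
  have avg: "expected_value h \<le> norm h * (2 * R) * (1 / real T)
      + V * (1 / real T * (\<Sum>t=1..T. (LINT \<omega>|M. cost N (W t \<omega>) (Q t \<omega>))))" if T: "1 \<le> T" for T
  proof -
    have "real T * expected_value h = (\<Sum>t=1..T. expected_value h)" by simp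
    also have "\<dots> \<le> (\<Sum>t=1..T. (LINT \<omega>|M. h \<bullet> increment N (Q t \<omega>)) + V * (LINT \<omega>|M. cost N (W t \<omega>) (Q t \<omega>)))"
      by (intro sum_mono one) simp
    also have "\<dots> \<le> norm h * (2 * R) + V * (\<Sum>t=1..T. (LINT \<omega>|M. cost N (W t \<omega>) (Q t \<omega>)))"
      using drift[of T] by (simp add: sum.distrib sum_distrib_left)
    finally show ?thesis
      using T by (simp add: field_simps)
  qed
  have "(\<lambda>T. norm h * (2 * R) * (1 / real T)
      + V * (1 / real T * (\<Sum>t=1..T. (LINT \<omega>|M. cost N (W t \<omega>) (Q t \<omega>))))) \<longlonglongrightarrow> norm h * (2 * R) * 0 + V * F"
    by (rule tendsto_add[OF tendsto_mult_left[OF lim_1_over_n]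
          tendsto_mult_left[OF F[unfolded long_run_cost_def]]])
  then have "expected_value h \<le> norm h * (2 * R) * 0 + V * F"
    by (rule tendsto_lowerbound[OF _ eventually_sequentiallyI[of 1]]) (rule avg, assumption, simp)
  then show ?thesis by simp
qed

lemma expected_value_le_P1_value: "expected_value h \<le> V * P1_value M W N"
proof -
  have "expected_value h / V \<le> P1_value M W N"
    unfolding P1_value_def
  proof (rule cInf_greatest)
    show "{F. \<exists>P. P1_feasible M W N P \<and> long_run_cost M W N P F} \<noteq> {}"
      using idle_policy by blast
    fix F assume "F \<in> {F. \<exists>P. P1_feasible M W N P \<and> long_run_cost M W N P F}"
    then have "expected_value h \<le> V * F"
      using offline_bound by blast
    then show "expected_value h / V \<le> F"
      using V_pos by (simp add: divide_le_eq mult.commute)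
  qed
  then show ?thesis
    using V_pos by (simp add: divide_le_eq mult.commute)
qed


section \<open>The online policy\<close>

text \<open>Virtual queues \<open>H\<close> determined by the slots before \<open>t\<close> are independent of the parameters of slot \<open>t\<close>. By
Fubini's theorem they may be frozen while the expectation over the parameters is taken, so a bound at
every constant carries over to \<open>H\<close>.\<close>

lemma expectation_value_at_past_state:
  assumes t: "1 \<le> t" and H: "H \<in> borel_measurable (info M W {1..<t})"
    and R: "\<And>\<omega>. \<omega> \<in> space M \<Longrightarrow> norm (H \<omega>) \<le> R"
    and c: "\<And>h. expected_value h \<le> c"
  shows "(LINT \<omega>|M. val (H \<omega>) t \<omega>) \<le> c"
proof -
  \<comment> \<open>The constant components give the two variables a common range type, as \<open>indep_var\<close> demands.\<close>
  define X where "X \<omega> = (H \<omega>, 0 :: (real^'j) \<times> (real^'i) \<times> (real^'i) \<times> (real^'i))" for \<omega>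
  define Y where "Y \<omega> = (0 :: (real^'j) \<times> (real^'i) \<times> (real^'i), slot_vec (W t \<omega>))" for \<omega>
  let ?f = "\<lambda>(x, y). slot_value N V (fst x) (snd y)"
  have H': "H \<in> borel_measurable M"
    by (rule measurable_from_info[OF H]) auto
  have X_info: "X \<in> borel_measurable (info M W {1..<t})"
    unfolding X_def by (intro borel_measurable_Pair H borel_measurable_const)
  have Y_info: "Y \<in> borel_measurable (info M W {t})"
    unfolding Y_def by (intro borel_measurable_Pair slot_vec_measurable_info borel_measurable_const) simp
  have X: "X \<in> borel_measurable M"
    by (rule measurable_from_info[OF X_info]) auto
  have Y: "Y \<in> borel_measurable M"
    by (rule measurable_from_info[OF Y_info]) (use t in auto)
  have "indep_var borel X borel Y"
    using t by (intro indep_var_info[OF X_info Y_info]) auto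
  then have joint: "distr M borel X \<Otimes>\<^sub>M distr M borel Y = distr M (borel \<Otimes>\<^sub>M borel) (\<lambda>\<omega>. (X \<omega>, Y \<omega>))"
    by (simp add: indep_var_distribution_eq)
  interpret D: pair_prob_space "distr M borel X" "distr M borel Y"
    by (intro pair_prob_space.intro pair_sigma_finite.intro prob_space_imp_sigma_finite prob_space_distr X Y)
  have pair: "(\<lambda>\<omega>. (X \<omega>, Y \<omega>)) \<in> M \<rightarrow>\<^sub>M borel \<Otimes>\<^sub>M borel"
    by (intro measurable_Pair X Y)
  have proj: "fst \<in> borel_measurable borel" "snd \<in> borel_measurable borel"
    by (intro borel_measurable_continuous_onI continuous_intros)+
  have f: "?f \<in> borel_measurable (borel \<Otimes>\<^sub>M borel)"
    using measurable_compose[OF measurable_Pair[OF measurable_compose[OF measurable_fst proj(1)]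
          measurable_compose[OF measurable_snd proj(2)]] slot_value_measurable]
    by (simp add: case_prod_beta')
  have "integrable M (\<lambda>\<omega>. ?f (X \<omega>, Y \<omega>))"
    using integrable_value[OF t H' R] by (simp add: X_def Y_def)
  then have int: "integrable (distr M borel X \<Otimes>\<^sub>M distr M borel Y) ?f"
    unfolding joint by (subst integrable_distr_eq[OF pair f])
  have inner: "(LINT y|distr M borel Y. ?f (x, y)) = expected_value (fst x)" for x
  proof -
    have "(LINT y|distr M borel Y. slot_value N V (fst x) (snd y)) = (LINT \<omega>|M. val (fst x) t \<omega>)"
      by (subst integral_distr[OF Y measurable_compose[OF proj(2) slot_value_measurable_snd]])
        (simp add: Y_def)
    then show ?thesis
      by (simp add: expectation_value[OF t])
  qed
  have "(LINT \<omega>|M. val (H \<omega>) t \<omega>) = (LINT z|(distr M borel X \<Otimes>\<^sub>M distr M borel Y). ?f z)"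
    unfolding joint by (subst integral_distr[OF pair f]) (simp add: X_def Y_def)
  also have "\<dots> = (LINT x|distr M borel X. expected_value (fst x))"
    using D.integral_fst'[OF int] unfolding inner by simp
  also have "\<dots> \<le> (LINT x|distr M borel X. c)"
    using D.integrable_fst'[OF int] unfolding inner by (intro integral_mono c) simp_all
  also have "\<dots> = c"
    using D.M1.prob_space by simp
  finally show ?thesis .
qed

lemma state_vec_measurable:
  assumes "\<And>\<tau>. 1 \<le> \<tau> \<Longrightarrow> measurable_decision (info M W {1..\<tau>}) (P \<tau>)"
  shows "(\<lambda>\<omega>. state_vec (state_at N (\<lambda>\<tau>. P \<tau> \<omega>) (Suc t))) \<in> borel_measurable (info M W {1..<Suc t})"
proof (induction t)
  case 0
  show ?case by simp
next
  case (Suc t)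
  have "(\<lambda>\<omega>. increment N (P (Suc t) \<omega>)) \<in> borel_measurable (info M W {1..<Suc (Suc t)})"
    by (rule measurable_info_mono[OF increment_measurable[OF assms]]) auto
  moreover have "(\<lambda>\<omega>. state_vec (state_at N (\<lambda>\<tau>. P \<tau> \<omega>) (Suc t))) \<in> borel_measurable (info M W {1..<Suc (Suc t)})"
    by (rule measurable_info_mono[OF Suc]) auto
  ultimately show ?case
    unfolding state_at.simps(2)[of N _ "Suc t"] by (simp add: state_vec_next_state del: state_at.simps)
qed

text \<open>The drift-plus-penalty argument. Half the squared norm of the virtual queues changes in a slot by at
most the drift term plus \<open>gap\<close>, and it never becomes negative; so the drift terms add up to at least
\<open>- T * gap\<close> minus the initial value \<open>L\<close>. As drift plus \<open>V\<close> times cost is the value of P2, whose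
expectation is at most \<open>c\<close>, the accumulated cost is bounded from above, and \<open>L\<close> disappears in the
average.

The virtual queues need not stay bounded uniformly in time; linear growth is enough for the
expectations to exist.\<close>

lemma online_bound:
  assumes P: "P2_policy M W N \<theta> \<phi> \<delta> r V P" and F: "long_run_cost M W N P F"
    and c: "\<And>h. expected_value h \<le> c"
  shows "V * F \<le> c + gap"
proof -
  let ?s = "\<lambda>t \<omega>. state_at N (\<lambda>\<tau>. P \<tau> \<omega>) t"
  let ?H = "\<lambda>t \<omega>. virtual_queues \<theta> \<phi> \<delta> r V (?s t \<omega>)"
  let ?inc = "\<lambda>t \<omega>. increment N (P t \<omega>)"
  let ?cost = "\<lambda>t \<omega>. cost N (W t \<omega>) (P t \<omega>)"
  define L where "L = (norm (virtual_queues \<theta> \<phi> \<delta> r V (init_state N)))\<^sup>2 / 2"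
  have meas: "measurable_decision (info M W {1..t}) (P t)" if "1 \<le> t" for t
    using P that by (simp add: P2_policy_def)
  have opt: "is_arg_min (penalty N V (?H t \<omega>) (W t \<omega>)) (slot_feasible N (W t \<omega>)) (P t \<omega>)"
    if "1 \<le> t" "\<omega> \<in> space M" for t \<omega>
    using P that by (simp add: P2_policy_def P2_optimal_def penalty_def[abs_def] drift_eq_inner)
  have slot: "slot_feasible N (W t \<omega>) (P t \<omega>)" if "1 \<le> t" "\<omega> \<in> space M" for t \<omega>
    using opt[OF that] by (simp add: is_arg_min_def)
  have inc_le: "(norm (?inc t \<omega>))\<^sup>2 \<le> 2 * gap" if "1 \<le> t" "\<omega> \<in> space M" for t \<omega>
    by (rule increment_le[OF that slot[OF that]])
  have attained: "val (?H t \<omega>) t \<omega> = ?H t \<omega> \<bullet> ?inc t \<omega> + V * ?cost t \<omega>"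
    if t: "1 \<le> t" and \<omega>: "\<omega> \<in> space M" for t \<omega>
    unfolding penalty_def[symmetric]
  proof (rule antisym)
    note w = plausible_params[OF t \<omega>]
    show "val (?H t \<omega>) t \<omega> \<le> penalty N V (?H t \<omega>) (W t \<omega>) (P t \<omega>)"
      using V_pos by (intro slot_value_le[OF network w slot[OF t \<omega>] arrival_square_le[OF t \<omega>]]) simp
    show "penalty N V (?H t \<omega>) (W t \<omega>) (P t \<omega>) \<le> val (?H t \<omega>) t \<omega>"
      using opt[OF t \<omega>] by (intro le_slot_value[OF network w]) (simp add: is_arg_min_linorder)
  qed
  have step: "?H (Suc (Suc t)) \<omega> = ?H (Suc t) \<omega> + ?inc (Suc t) \<omega>" for t \<omega>
    by (simp add: virtual_queues_def state_vec_next_state)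
  have H_bound: "norm (?H (Suc t) \<omega>) \<le> norm (virtual_queues \<theta> \<phi> \<delta> r V (init_state N)) + t * sqrt (2 * gap)"
    if \<omega>: "\<omega> \<in> space M" for t \<omega>
  proof (induction t)
    case (Suc t)
    have "norm (?inc (Suc t) \<omega>) \<le> sqrt (2 * gap)"
      by (intro real_le_rsqrt inc_le \<omega>) simp
    with Suc norm_triangle_ineq[of "?H (Suc t) \<omega>" "?inc (Suc t) \<omega>"] show ?case
      unfolding step by (simp add: algebra_simps del: state_at.simps)
  qed simp
  have H_info: "?H t \<in> borel_measurable (info M W {1..<t})" if t: "1 \<le> t" for t
  proof -
    obtain u where "t = Suc u" using t by (cases t) auto
    then show ?thesis
      using state_vec_measurable[OF meas, of u] unfolding virtual_queues_def
      by (simp del: state_at.simps)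
  qed
  have H_norm: "norm (?H t \<omega>) \<le> norm (virtual_queues \<theta> \<phi> \<delta> r V (init_state N)) + t * sqrt (2 * gap)"
    if "1 \<le> t" "\<omega> \<in> space M" for t \<omega>
    using H_bound[OF that(2), of "t - 1"] that(1) gap_nonneg
      mult_right_mono[of "real (t - 1)" "real t" "sqrt (2 * gap)"] by simp
  have H_M: "?H t \<in> borel_measurable M" if "1 \<le> t" for t
    by (rule measurable_from_info[OF H_info[OF that]]) auto
  have int_val: "integrable M (\<lambda>\<omega>. val (?H t \<omega>) t \<omega>)" if t: "1 \<le> t" for t
    by (rule integrable_value[OF t H_M[OF t] H_norm[OF t]])
  have int_drift: "integrable M (\<lambda>\<omega>. ?H t \<omega> \<bullet> ?inc t \<omega>)" if t: "1 \<le> t" for t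
  proof (rule integrable_const_bound)
    have "?inc t \<in> borel_measurable M"
      by (rule measurable_from_info[OF increment_measurable[OF meas[OF t]]]) auto
    then show "(\<lambda>\<omega>. ?H t \<omega> \<bullet> ?inc t \<omega>) \<in> borel_measurable M"
      using H_M[OF t] by (intro borel_measurable_inner)
    show "AE \<omega> in M. norm (?H t \<omega> \<bullet> ?inc t \<omega>)
        \<le> (norm (virtual_queues \<theta> \<phi> \<delta> r V (init_state N)) + t * sqrt (2 * gap)) * sqrt (2 * gap)"
    proof (intro AE_I2)
      fix \<omega> assume \<omega>: "\<omega> \<in> space M"
      show "norm (?H t \<omega> \<bullet> ?inc t \<omega>)
        \<le> (norm (virtual_queues \<theta> \<phi> \<delta> r V (init_state N)) + t * sqrt (2 * gap)) * sqrt (2 * gap)"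
        using inner_increment_bound[OF inc_le[OF t \<omega>], of "?H t \<omega>"]
          mult_right_mono[OF H_norm[OF t \<omega>], of "sqrt (2 * gap)"] gap_nonneg
        by simp
    qed
  qed
  have exp: "(LINT \<omega>|M. ?H t \<omega> \<bullet> ?inc t \<omega>) + V * (LINT \<omega>|M. ?cost t \<omega>) \<le> c" if t: "1 \<le> t" for t
  proof -
    have "(LINT \<omega>|M. val (?H t \<omega>) t \<omega> - ?H t \<omega> \<bullet> ?inc t \<omega>) = (LINT \<omega>|M. V * ?cost t \<omega>)"
      by (intro Bochner_Integration.integral_cong refl) (simp add: attained[OF t])
    then have "(LINT \<omega>|M. val (?H t \<omega>) t \<omega>) = (LINT \<omega>|M. ?H t \<omega> \<bullet> ?inc t \<omega>) + V * (LINT \<omega>|M. ?cost t \<omega>)"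
      using int_val[OF t] int_drift[OF t] by simp
    moreover have "(LINT \<omega>|M. val (?H t \<omega>) t \<omega>) \<le> c"
      by (rule expectation_value_at_past_state[OF t H_info[OF t] H_norm[OF t] c])
    ultimately show ?thesis by simp
  qed
  have lyapunov: "(norm (?H (Suc T) \<omega>))\<^sup>2 / 2 \<le> L + T * gap + (\<Sum>t=1..T. ?H t \<omega> \<bullet> ?inc t \<omega>)"
    if \<omega>: "\<omega> \<in> space M" for T \<omega>
  proof (induction T)
    case 0
    show ?case by (simp add: L_def)
  next
    case (Suc T)
    have "(norm (?H (Suc T) \<omega> + ?inc (Suc T) \<omega>))\<^sup>2
        = (norm (?H (Suc T) \<omega>))\<^sup>2 + 2 * (?H (Suc T) \<omega> \<bullet> ?inc (Suc T) \<omega>) + (norm (?inc (Suc T) \<omega>))\<^sup>2"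
      by (simp add: power2_norm_eq_inner inner_add_left inner_add_right inner_commute del: state_at.simps)
    moreover have "(norm (?inc (Suc T) \<omega>))\<^sup>2 \<le> 2 * gap"
      by (intro inc_le \<omega>) simp
    ultimately show ?case
      using Suc unfolding step
      by (simp add: algebra_simps add_divide_distrib del: state_at.simps)
  qed
  have drift: "0 \<le> L + T * gap + (\<Sum>t=1..T. (LINT \<omega>|M. ?H t \<omega> \<bullet> ?inc t \<omega>))" for T :: nat
  proof -
    have "0 \<le> (LINT \<omega>|M. L + T * gap + (\<Sum>t=1..T. ?H t \<omega> \<bullet> ?inc t \<omega>))"
    proof (intro integral_nonneg_AE AE_I2)
      fix \<omega> assume "\<omega> \<in> space M"
      from order_trans[OF _ lyapunov[OF this, of T]]
      show "0 \<le> L + T * gap + (\<Sum>t=1..T. ?H t \<omega> \<bullet> ?inc t \<omega>)" by simp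
    qed
    also have "\<dots> = (LINT \<omega>|M. L + T * gap) + (LINT \<omega>|M. (\<Sum>t=1..T. ?H t \<omega> \<bullet> ?inc t \<omega>))"
      using int_drift by (intro Bochner_Integration.integral_add Bochner_Integration.integrable_sum) auto
    also have "(LINT \<omega>|M. (\<Sum>t=1..T. ?H t \<omega> \<bullet> ?inc t \<omega>)) = (\<Sum>t=1..T. (LINT \<omega>|M. ?H t \<omega> \<bullet> ?inc t \<omega>))"
      using int_drift by (intro Bochner_Integration.integral_sum) auto
    finally show ?thesis by (simp add: prob_space)
  qed
  have avg: "V * (1 / real T * (\<Sum>t=1..T. (LINT \<omega>|M. ?cost t \<omega>))) \<le> L * (1 / real T) + (c + gap)"
    if T: "1 \<le> T" for T
  proof -
    have "(\<Sum>t=1..T. (LINT \<omega>|M. ?H t \<omega> \<bullet> ?inc t \<omega>) + V * (LINT \<omega>|M. ?cost t \<omega>)) \<le> (\<Sum>t=1..T. c)"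
      by (intro sum_mono exp) simp
    then have "V * (\<Sum>t=1..T. (LINT \<omega>|M. ?cost t \<omega>)) \<le> L + real T * (c + gap)"
      using drift[of T] by (simp add: sum.distrib sum_distrib_left algebra_simps)
    then have "V * (\<Sum>t=1..T. (LINT \<omega>|M. ?cost t \<omega>)) / real T \<le> (L + real T * (c + gap)) / real T"
      using T by (intro divide_right_mono) auto
    then show ?thesis
      using T by (simp add: add_divide_distrib)
  qed
  have "(\<lambda>T. V * (1 / real T * (\<Sum>t=1..T. (LINT \<omega>|M. ?cost t \<omega>)))) \<longlonglongrightarrow> V * F"
    by (rule tendsto_mult_left[OF F[unfolded long_run_cost_def]])
  moreover have "(\<lambda>T. L * (1 / real T) + (c + gap)) \<longlonglongrightarrow> L * 0 + (c + gap)"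
    by (rule tendsto_add[OF tendsto_mult_left[OF lim_1_over_n] tendsto_const])
  ultimately have "V * F \<le> L * 0 + (c + gap)"
    by (rule LIMSEQ_le) (use avg in blast)
  then show ?thesis by simp
qed

end

theorem proposition2:
  fixes M :: "'w measure"
    and N :: "('i::finite, 'j::finite) network"
    and W :: "nat \<Rightarrow> 'w \<Rightarrow> ('i, 'j) slot_params"
    and P :: "nat \<Rightarrow> 'w \<Rightarrow> ('i, 'j) decision"
    and \<theta> :: "'j \<Rightarrow> real" and \<phi> \<delta> r :: "'i \<Rightarrow> real"
    and V Fhat :: real
  assumes "prob_space M"
    and "valid_network N"
    and "valid_params M W"
    and "iid_params M W"
    and "standing_assumptions M W N"
    and "V > 0"
    and "P2_policy M W N \<theta> \<phi> \<delta> r V P"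
    and "long_run_cost M W N P Fhat"
  shows "Fhat - P1_value M W N \<le> 1 / V * (N1 M W N + N2 N + N3 N)"
proof -
  interpret iid_system M N W V
    using assms by (intro iid_system.intro iid_system_axioms.intro)
  have "V * Fhat \<le> V * P1_value M W N + (N1 M W N + N2 N + N3 N)"
    by (rule online_bound[OF assms(7,8) expected_value_le_P1_value])
  then show ?thesis
    using assms(6) by (simp add: field_simps)
qed

end
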